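(* Let $k>0$, let $\Omega=[0,L_x]\times[0,L_y]\subset\mathbb{R}^2$ with $L_x,L_y>0$, and let $V\in L^\infty$ be compactly supported in $\Omega$. Let $\psi_0$ be a continuous incident field with $\mathrm{i}\beta\,\partial_x\psi_0+\mathrm{i}\alpha\,\partial_y\psi_0-k\psi_0=0$. Define $$\mu_a:=k\,\sup_{\mathbf{x}\in\Omega}\int_\Omega\|G(\mathbf{x},\mathbf{x}')\|_1\,d\mathbf{x}'.$$ If $\|V\|_{L^\infty(\Omega)}\le \dfrac{1}{\mu_a}$, then the anti-chiral Dirac equation $$\mathrm{i}\,\beta\,\partial_x\psi+\mathrm{i}\,\alpha\,\partial_y\psi+k\,(V(x,y)-1)\,\psi=0$$ with incident field $\psi_0$ admits a unique solution $\psi=\psi_0+\psi_s$ in $C(\Omega;\mathbb{C}^2)$; that is, there is a unique $\psi_s\in C(\Omega;\mathbb{C}^2)$ such that for all $\mathbf{x}\in\Omega$ $$\psi_s(\mathbf{x})=-k\int_\Omega G(\mathbf{x},\mathbf{x}')\,V(\mathbf{x}')\,\bigl(\psi_0(\mathbf{x}')+\psi_s(\mathbf{x}')\bigr)\,d\mathbf{x}'.$$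
   Context: $\alpha=\begin{pmatrix}0&1\\1&0\end{pmatrix}$, $\beta=\begin{pmatrix}1&0\\0&-1\end{pmatrix}$, $I$ is the $2\times2$ identity matrix, and $V$ is a scalar function. For $\mathbf{x}=(x,y)$ and $\mathbf{x}'=(x',y')$ with $\mathbf{x}\ne\mathbf{x}'$, the Green's function of $\mathrm{i}\beta\partial_x+\mathrm{i}\alpha\partial_y-k$ is $$G(\mathbf{x},\mathbf{x}')=\frac{k}{4}\Bigl(\mathrm{i}H^{(1)}_0(k|\mathbf{x}-\mathbf{x}'|)\,I+H^{(1)}_1(k|\mathbf{x}-\mathbf{x}'|)\Bigl(\frac{x-x'}{|\mathbf{x}-\mathbf{x}'|}\beta+\frac{y-y'}{|\mathbf{x}-\mathbf{x}'|}\alpha\Bigr)\Bigr),$$ where $H^{(1)}_l$ are Hankel functions of the first kind. $\|\cdot\|_1$ is the matrix $1$-norm (maximum absolute column sum). The total field is $\psi=\psi_0+\psi_s$, with the scattered field $\psi_s$ subject to the radiation condition $\lim_{r\to\infty}\sqrt r\,(\partial_r\psi_s-\mathrm{i}k\psi_s)=0$; a solution is understood as a solution of the Lippmann--Schwinger integral equation displayed in the claim. *)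

theory Defs
  imports "HOL-Analysis.Analysis" "HOL-Probability.Essential_Supremum"
begin

definition bessel_J :: "nat \<Rightarrow> real \<Rightarrow> real" where
  "bessel_J n z = (z / 2) ^ n * (\<Sum>m. (- (z\<^sup>2 / 4)) ^ m / (fact m * fact (n + m)))"

text \<open>The standard series for the Bessel function of the second kind of integer order
  (Digital Library of Mathematical Functions, 10.8.1); it is meant for \<open>z > 0\<close>.\<close>

definition bessel_Y :: "nat \<Rightarrow> real \<Rightarrow> real" where
  "bessel_Y n z =
     - (1 / (pi * (z / 2) ^ n)) * (\<Sum>m<n. fact (n - m - 1) / fact m * (z\<^sup>2 / 4) ^ m)
     + 2 / pi * ln (z / 2) * bessel_J n z
     - (z / 2) ^ n / pi *
         (\<Sum>m. (Digamma (real m + 1) + Digamma (real (n + m) + 1))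
               * (- (z\<^sup>2 / 4)) ^ m / (fact m * fact (n + m)))"

definition hankel1 :: "nat \<Rightarrow> real \<Rightarrow> complex" where
  "hankel1 n z = Complex (bessel_J n z) (bessel_Y n z)"

definition alpha_mat :: "complex^2^2" where
  "alpha_mat = vector [vector [0, 1], vector [1, 0]]"

definition beta_mat :: "complex^2^2" where
  "beta_mat = vector [vector [1, 0], vector [0, -1]]"

text \<open>On the diagonal \<open>p = q\<close>, where the Green's function is not defined, this has
  an arbitrary value; the diagonal is a null set in every integral below.\<close>

definition green :: "real \<Rightarrow> real \<times> real \<Rightarrow> real \<times> real \<Rightarrow> complex^2^2" where
  "green k p q = (\<chi> i j. complex_of_real (k / 4) *
     (\<i> * hankel1 0 (k * norm (p - q)) * (mat 1 :: complex^2^2) $ i $ j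
      + hankel1 1 (k * norm (p - q)) *
          (complex_of_real ((fst p - fst q) / norm (p - q)) * beta_mat $ i $ j
           + complex_of_real ((snd p - snd q) / norm (p - q)) * alpha_mat $ i $ j)))"

definition mat_norm_1 :: "complex^'n^'m \<Rightarrow> real" where
  "mat_norm_1 A = (MAX j\<in>UNIV. \<Sum>i\<in>UNIV. cmod (A $ i $ j))"

definition Omega :: "real \<Rightarrow> real \<Rightarrow> (real \<times> real) set" where
  "Omega Lx Ly = {0..Lx} \<times> {0..Ly}"

definition mu_a :: "real \<Rightarrow> (real \<times> real) set \<Rightarrow> real" where
  "mu_a k \<Omega> = k * (SUP p\<in>\<Omega>. LINT q:\<Omega>|lebesgue. mat_norm_1 (green k p q))"

definition Linf_norm :: "(real \<times> real) set \<Rightarrow> (real \<times> real \<Rightarrow> complex) \<Rightarrow> ereal" where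
  "Linf_norm S V = esssup (restrict_space lebesgue S) (\<lambda>p. ereal (cmod (V p)))"

definition in_Linf :: "(real \<times> real \<Rightarrow> complex) \<Rightarrow> bool" where
  "in_Linf V \<longleftrightarrow> V \<in> borel_measurable lebesgue \<and> Linf_norm UNIV V < \<infinity>"

text \<open>The support of the almost-everywhere class of \<open>V\<close>.\<close>

definition ess_support :: "(real \<times> real \<Rightarrow> complex) \<Rightarrow> (real \<times> real) set" where
  "ess_support V = - \<Union>{U. open U \<and> (AE p in lebesgue. p \<in> U \<longrightarrow> V p = 0)}"

text \<open>\<open>\<psi>\<close> solves \<open>i \<beta> \<partial>\<^sub>x \<psi> + i \<alpha> \<partial>\<^sub>y \<psi> - k \<psi> = 0\<close>
  at every point of \<open>U\<close>, with classical partial derivatives.\<close>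

definition free_dirac_on :: "(real \<times> real) set \<Rightarrow> real \<Rightarrow> (real \<times> real \<Rightarrow> complex^2) \<Rightarrow> bool" where
  "free_dirac_on U k \<psi> \<longleftrightarrow> (\<forall>(x, y)\<in>U. \<exists>dx dy.
     ((\<lambda>s. \<psi> (s, y)) has_vector_derivative dx) (at x) \<and>
     ((\<lambda>t. \<psi> (x, t)) has_vector_derivative dy) (at y) \<and>
     \<i> *s (beta_mat *v dx) + \<i> *s (alpha_mat *v dy) - complex_of_real k *s \<psi> (x, y) = 0)"

text \<open>The space \<open>C(\<Omega>; \<complex>\<^sup>2)\<close>: functions are normalised to \<open>undefined\<close> off \<open>\<Omega>\<close>, so that
  equality of functions is equality on \<open>\<Omega>\<close>.\<close>

definition C_fun :: "(real \<times> real) set \<Rightarrow> (real \<times> real \<Rightarrow> complex^2) set" where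
  "C_fun \<Omega> = {f \<in> extensional \<Omega>. continuous_on \<Omega> f}"

definition lippmann_schwinger ::
  "real \<Rightarrow> (real \<times> real) set \<Rightarrow> (real \<times> real \<Rightarrow> complex) \<Rightarrow>
   (real \<times> real \<Rightarrow> complex^2) \<Rightarrow> (real \<times> real \<Rightarrow> complex^2) \<Rightarrow> bool" where
  "lippmann_schwinger k \<Omega> V \<psi>\<^sub>0 \<psi>\<^sub>s \<longleftrightarrow> (\<forall>p\<in>\<Omega>.
     \<psi>\<^sub>s p = - k *\<^sub>R (LINT q:\<Omega>|lebesgue. green k p q *v (V q *s (\<psi>\<^sub>0 q + \<psi>\<^sub>s q))))"

end

theory Submission
  imports Defs "HOL-Complex_Analysis.Great_Picard" "HOL-Real_Asymp.Real_Asymp"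
begin

text \<open>
  Write \<open>K f p = - k \<integral>\<^sub>S G(p, q) V(q) f(q) dq\<close> with \<open>S = \<Omega>\<close>, so that the integral equation reads
  \<open>\<psi>\<^sub>s = K \<psi>\<^sub>0 + K \<psi>\<^sub>s\<close>. Measure vectors of \<open>\<complex>\<^sup>2\<close> in the 1-norm and functions by its supremum over
  \<open>S\<close>. The definition of \<open>\<mu>\<^sub>a\<close> and the bound on \<open>V\<close> give \<open>\<parallel>K\<parallel> \<le> 1\<close>, and only that: when
  \<open>\<parallel>V\<parallel> = 1 / \<mu>\<^sub>a\<close> the contraction principle does not apply to \<open>K\<close>. The point of the proof is that
  \<open>K\<^sup>3\<close> is nevertheless a strict contraction, \<open>\<parallel>K\<^sup>3\<parallel> < 1\<close>. Then the Neumann series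
  \<open>\<Sum> K\<^sup>n (K \<psi>\<^sub>0)\<close> converges geometrically and gives a solution, and a difference \<open>d\<close> of two
  solutions vanishes because \<open>d = K d = K\<^sup>3 d\<close>.

  Suppose \<open>\<parallel>K\<^sup>3\<parallel> = 1\<close>. The kernel has a singularity of order \<open>1 / |p - q|\<close>, which is integrable in
  the plane, uniformly in \<open>p\<close>; hence \<open>K\<close> maps the unit ball to an equicontinuous family, and by
  Arzela--Ascoli there is a continuous \<open>g\<close> with \<open>\<parallel>g\<parallel> \<le> 1\<close> and \<open>\<parallel>K (K g) p\<parallel> = 1\<close> at some point
  \<open>p\<close> (\<open>K_K_K_strict\<close>). Then every inequality in the estimate of \<open>K (K g) p\<close> is an equality. In
  particular \<open>K g\<close> has norm 1 at all interior points near \<open>p\<close>, so the same equalities hold for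
  \<open>K g p'\<close>, with \<open>p'\<close> ranging over an open set \<open>U\<close>: for \<open>p', q \<in> U\<close> the vector \<open>g q\<close> attains the 1-norm of the matrix
  \<open>G(p', q)\<close>, and the components of \<open>G(p', q) g(q)\<close> have a relative phase independent of \<open>q\<close>
  (\<open>equality_pointwise\<close>).

  This is impossible (\<open>norm_not_attained_on_open\<close>), since reflecting \<open>p' - q\<close> in a coordinate axis
  changes the sign of some entries of
  \<open>G = k/4 \<cdot> ((a + b c, b s), (b s, a - b c))\<close>, where \<open>a = i H\<^sub>0\<close>, \<open>b = H\<^sub>1\<close> are evaluated at
  \<open>k |p' - q|\<close> and \<open>(c, s)\<close> is the unit vector along \<open>p' - q\<close>, and leaves the others unchanged. If
  both components of \<open>g q\<close> are nonzero, attaining the norm for \<open>s\<close> and for \<open>- s\<close> forces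
  \<open>a + b c = a - b c = 0\<close>. If one of them vanishes throughout a neighbourhood, the constant relative
  phase, compared for \<open>s\<close> and \<open>- s\<close>, forces \<open>a + b c = 0\<close> or \<open>a - b c = 0\<close>, and compared for \<open>- c\<close>
  also the other one. Either way \<open>b c = 0\<close>, while \<open>H\<^sub>1\<close> has no zeros near \<open>0\<close>.
\<close>

section \<open>Bessel and Hankel functions near the origin\<close>

lemma continuous_on_entire_series:
  fixes c :: "nat \<Rightarrow> real"
  assumes c: "\<And>m. \<bar>c m\<bar> \<le> K * 2 ^ m / fact m"
  shows "continuous_on UNIV (\<lambda>z::real. \<Sum>m. c m * (- (z\<^sup>2 / 4)) ^ m)"
proof -
  have "summable (\<lambda>m. c m * y ^ m)" for y :: real
  proof (rule summable_comparison_test')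
    show "summable (\<lambda>m. K * ((2 * \<bar>y\<bar>) ^ m / fact m))"
      using summable_exp[of "2 * \<bar>y\<bar>"] by (intro summable_mult) (simp add: field_simps)
    show "norm (c m * y ^ m) \<le> K * ((2 * \<bar>y\<bar>) ^ m / fact m)" for m
      using mult_right_mono[OF c[of m], of "\<bar>y\<bar> ^ m"]
      by (simp add: abs_mult power_abs power_mult_distrib)
  qed
  then have "continuous_on UNIV (\<lambda>y::real. \<Sum>m. c m * y ^ m)"
    by (auto simp: continuous_on_eq_continuous_at intro: isCont_powser_converges_everywhere)
  then show ?thesis
    by (rule continuous_on_compose2) (auto intro!: continuous_intros)
qed

text \<open>The Digamma series of \<open>bessel_Y\<close>: once the logarithm and the negative powers of \<open>z\<close> are split
  off, what remains of the function is entire, so it does not affect the behaviour at \<open>0\<close>.\<close>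

definition bessel_Y_entire :: "nat \<Rightarrow> real \<Rightarrow> real" where
  "bessel_Y_entire n z = (z / 2) ^ n / pi *
     (\<Sum>m. (Digamma (real m + 1) + Digamma (real (n + m) + 1)) / (fact m * fact (n + m))
        * (- (z\<^sup>2 / 4)) ^ m)"

lemma bessel_Y_split:
  "bessel_Y n z = - (1 / (pi * (z / 2) ^ n)) * (\<Sum>m<n. fact (n - m - 1) / fact m * (z\<^sup>2 / 4) ^ m)
     + 2 / pi * (ln (z / 2) * bessel_J n z) - bessel_Y_entire n z"
  unfolding bessel_Y_def bessel_Y_entire_def by (simp add: mult_ac)

lemma continuous_on_bessel_J: "continuous_on UNIV (bessel_J n)"
proof -
  have "continuous_on UNIV (\<lambda>z::real. \<Sum>m. 1 / (fact m * fact (n + m)) * (- (z\<^sup>2 / 4)) ^ m)"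
  proof (rule continuous_on_entire_series)
    show "\<bar>1 / (fact m * fact (n + m))\<bar> \<le> (1::real) * 2 ^ m / fact m" for m
    proof -
      have "(1::real) / fact (n + m) \<le> 2 ^ m"
        by (rule order_trans[where y = 1]) (simp_all add: fact_ge_1)
      then have "(1::real) / fact (n + m) / fact m \<le> 2 ^ m / fact m"
        by (rule divide_right_mono) simp
      then show ?thesis by (simp add: mult.commute)
    qed
  qed
  then have "continuous_on UNIV (\<lambda>z::real. (z / 2) ^ n *
      (\<Sum>m. 1 / (fact m * fact (n + m)) * (- (z\<^sup>2 / 4)) ^ m))"
    by (intro continuous_on_mult continuous_on_power continuous_on_divide continuous_on_id
        continuous_on_const) auto
  moreover have "bessel_J n = (\<lambda>z. (z / 2) ^ n *
      (\<Sum>m. 1 / (fact m * fact (n + m)) * (- (z\<^sup>2 / 4)) ^ m))"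
    by (simp add: fun_eq_iff bessel_J_def)
  ultimately show ?thesis by simp
qed

text \<open>At integers the Digamma function is a harmonic number up to a constant. Linear growth is all that
  the convergence of the Digamma series needs.\<close>

lemma abs_Digamma_le: "\<bar>Digamma (real m + 1)\<bar> \<le> real m + \<bar>euler_mascheroni\<bar>"
proof -
  have "Digamma (real m + 1) = harm m - euler_mascheroni"
    using Digamma_of_nat[of m, where 'a = real] by (simp add: add.commute)
  moreover have "harm m \<le> real m"
    unfolding harm_def using sum_bounded_above[of "{1..m}" "\<lambda>k. inverse (real k)" 1]
    by (simp add: inverse_le_1_iff)
  moreover have "(0::real) \<le> harm m"
    by (rule harm_nonneg)
  ultimately show ?thesis by linarith
qed

lemma continuous_on_bessel_Y_entire: "continuous_on UNIV (bessel_Y_entire n)"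
proof -
  define K where "K = real n + 2 + 2 * \<bar>euler_mascheroni :: real\<bar>"
  have "continuous_on UNIV (\<lambda>z::real. \<Sum>m. (Digamma (real m + 1) + Digamma (real (n + m) + 1))
          / (fact m * fact (n + m)) * (- (z\<^sup>2 / 4)) ^ m)"
  proof (rule continuous_on_entire_series)
    fix m
    let ?D = "Digamma (real m + 1) + Digamma (real (n + m) + 1)"
    have "\<bar>?D\<bar> \<le> real m + \<bar>euler_mascheroni\<bar> + (real (n + m) + \<bar>euler_mascheroni\<bar>)"
      using abs_Digamma_le[of m] abs_Digamma_le[of "n + m"] by linarith
    also have "\<dots> \<le> 2 * real m + K" by (simp add: K_def)
    also have "\<dots> \<le> K * (1 + real m)" by (simp add: K_def algebra_simps)
    also have "\<dots> \<le> K * 2 ^ m"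
    proof (rule mult_left_mono)
      have "Suc m \<le> 2 ^ m"
        using less_exp[of m] by (rule Suc_leI)
      then show "1 + real m \<le> 2 ^ m"
        by (metis of_nat_Suc of_nat_le_iff of_nat_numeral of_nat_power)
    qed (simp add: K_def)
    finally have "\<bar>?D\<bar> \<le> K * 2 ^ m" .
    have "\<bar>?D / (fact m * fact (n + m))\<bar> = \<bar>?D\<bar> / fact m / fact (n + m)"
      by (simp add: abs_mult)
    also have "\<dots> \<le> \<bar>?D\<bar> / fact m / 1"
      using fact_ge_1[of "n + m", where 'a = real] by (intro divide_left_mono) auto
    also have "\<dots> \<le> K * 2 ^ m / fact m"
      using \<open>\<bar>?D\<bar> \<le> K * 2 ^ m\<close> by (simp add: divide_right_mono)
    finally show "\<bar>?D / (fact m * fact (n + m))\<bar> \<le> K * 2 ^ m / fact m" .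
  qed
  then show ?thesis
    unfolding bessel_Y_entire_def [abs_def] by (auto intro!: continuous_intros)
qed

lemma continuous_on_hankel1: "continuous_on {0<..} (hankel1 n)"
proof -
  have J: "continuous_on {0<..} (bessel_J n)"
    by (rule continuous_on_subset[OF continuous_on_bessel_J subset_UNIV])
  have E: "continuous_on {0<..} (bessel_Y_entire n)"
    by (rule continuous_on_subset[OF continuous_on_bessel_Y_entire subset_UNIV])
  have Y: "continuous_on {0<..} (bessel_Y n)"
    unfolding bessel_Y_split [abs_def] by (auto intro!: continuous_intros J E)
  have "hankel1 n = (\<lambda>z. of_real (bessel_J n z) + \<i> * of_real (bessel_Y n z))"
    by (simp add: fun_eq_iff hankel1_def Complex_eq)
  moreover have "continuous_on {0<..} (\<lambda>z. of_real (bessel_J n z) + \<i> * of_real (bessel_Y n z))"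
    by (intro continuous_on_add continuous_on_mult continuous_on_const continuous_on_of_real J Y)
  ultimately show ?thesis by simp
qed

lemma tendsto_mult_ln: "((\<lambda>z::real. z * ln (z / 2)) \<longlongrightarrow> 0) (at_right 0)"
  by real_asymp

lemma tendsto_at_0_continuous:
  fixes f :: "real \<Rightarrow> real"
  assumes "continuous_on UNIV f"
  shows "(f \<longlongrightarrow> f 0) (at_right 0)"
proof -
  have "(f \<longlongrightarrow> f 0) (at 0)"
    using assms by (simp add: continuous_on_eq_continuous_at isCont_def)
  then show ?thesis by (simp add: filterlim_at_split)
qed

text \<open>Multiplication by \<open>z\<close> removes the logarithm in both functions; of the negative powers only the
  term \<open>- 2 / (\<pi> z)\<close> of \<open>Y\<^sub>1\<close> survives. The limit serves twice: it bounds the singularity of the Green's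
  function by \<open>1 / z\<close>, and for \<open>n = 1\<close> it is nonzero, so \<open>H\<^sub>1\<close> has no zeros near \<open>0\<close>.\<close>

lemma tendsto_mult_hankel1:
  assumes "n \<le> 1"
  shows "((\<lambda>z. of_real z * hankel1 n z) \<longlongrightarrow> of_nat n * (- 2 / of_real pi * \<i>)) (at_right 0)"
proof -
  note J = tendsto_at_0_continuous[OF continuous_on_bessel_J[of n]]
  note E = tendsto_at_0_continuous[OF continuous_on_bessel_Y_entire[of n]]
  have id: "((\<lambda>z::real. z) \<longlongrightarrow> 0) (at_right 0)" by real_asymp
  have "((\<lambda>z. - 2 / pi * real n + 2 / pi * (z * ln (z / 2) * bessel_J n z) - z * bessel_Y_entire n z)
      \<longlongrightarrow> - 2 / pi * real n + 2 / pi * (0 * bessel_J n 0) - 0 * bessel_Y_entire n 0) (at_right 0)"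
    by (intro tendsto_intros tendsto_mult_ln J E id)
  then have "((\<lambda>z. z * bessel_Y n z) \<longlongrightarrow> - 2 / pi * real n) (at_right 0)"
  proof (rule tendsto_cong[THEN iffD1, rotated, OF tendsto_eq_rhs])
    have "- 2 / pi * real n + 2 / pi * (z * ln (z / 2) * bessel_J n z) - z * bessel_Y_entire n z
        = z * bessel_Y n z" if "z > 0" for z
      using assms that by (cases n) (auto simp: bessel_Y_split field_simps)
    then show "eventually (\<lambda>z. - 2 / pi * real n + 2 / pi * (z * ln (z / 2) * bessel_J n z)
        - z * bessel_Y_entire n z = z * bessel_Y n z) (at_right 0)"
      by (auto simp: eventually_at_filter)
  qed simp
  moreover have "((\<lambda>z. z * bessel_J n z) \<longlongrightarrow> 0 * bessel_J n 0) (at_right 0)"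
    by (intro tendsto_intros J id)
  ultimately have "((\<lambda>z. Complex (z * bessel_J n z) (z * bessel_Y n z))
      \<longlongrightarrow> Complex 0 (- 2 / pi * real n)) (at_right 0)"
    by (intro tendsto_Complex) auto
  moreover have "Complex 0 (- 2 / pi * real n) = of_nat n * (- 2 / of_real pi * \<i>)"
    by (simp add: complex_eq_iff)
  moreover have "Complex (z * bessel_J n z) (z * bessel_Y n z) = of_real z * hankel1 n z" for z
    by (simp add: hankel1_def complex_eq_iff)
  ultimately show ?thesis by simp
qed

lemma hankel1_bound:
  assumes "n \<le> 1"
  obtains C where "\<And>z. 0 < z \<Longrightarrow> z \<le> R \<Longrightarrow> cmod (hankel1 n z) * z \<le> C"
proof -
  define F where "F z = (if z \<le> 0 then of_nat n * (- 2 / of_real pi * \<i>) else of_real z * hankel1 n z)" for z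
  have "continuous_on {0..R} F"
  proof (rule continuous_on_subset)
    have "isCont F z" if "z > 0" for z
    proof -
      have "eventually (\<lambda>w. F w = of_real w * hankel1 n w) (nhds z)"
        using eventually_nhds_in_open[of "{0<..}" z] that
        by (auto simp: F_def elim!: eventually_mono)
      moreover have "isCont (\<lambda>w. of_real w * hankel1 n w) z"
        using continuous_on_hankel1[of n] that
        by (intro continuous_intros) (simp add: continuous_on_eq_continuous_at)
      ultimately show ?thesis by (simp add: isCont_cong)
    qed
    moreover have "continuous (at 0 within {0..}) F"
    proof -
      have "(F \<longlongrightarrow> F 0) (at_right 0)"
      proof (rule tendsto_cong[THEN iffD1, OF _ tendsto_eq_rhs[OF tendsto_mult_hankel1[OF assms]]])
        show "eventually (\<lambda>z. of_real z * hankel1 n z = F z) (at_right 0)"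
          by (auto simp: eventually_at_filter F_def)
      qed (simp add: F_def)
      then show ?thesis
        by (simp add: continuous_within at_within_Ici_at_right)
    qed
    ultimately show "continuous_on {0..} F"
      unfolding continuous_on_eq_continuous_within
      by (metis atLeast_iff continuous_at_imp_continuous_at_within less_eq_real_def)
  qed simp
  then have "bounded (F ` {0..R})"
    by (intro compact_imp_bounded compact_continuous_image) auto
  then obtain C where C: "\<And>z. z \<in> {0..R} \<Longrightarrow> norm (F z) \<le> C"
    unfolding bounded_iff by (metis imageI)
  have "cmod (hankel1 n z) * z \<le> C" if "0 < z" "z \<le> R" for z
    using C[of z] that by (simp add: F_def norm_mult mult.commute)
  then show ?thesis by (rule that)
qed

lemma hankel1_1_nonzero_near_0:
  obtains r where "r > 0" "\<And>z. 0 < z \<Longrightarrow> z < r \<Longrightarrow> hankel1 1 z \<noteq> 0"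
proof -
  have "eventually (\<lambda>z. of_real z * hankel1 1 z \<noteq> 0) (at_right 0)"
    using tendsto_mult_hankel1[of 1] by (rule tendsto_imp_eventually_ne) (auto simp: complex_eq_iff)
  then show ?thesis
    using that by (force simp: eventually_at_right_field)
qed

section \<open>Weakly singular kernels in the plane\<close>

text \<open>The model singularity \<open>1 / |p - q|\<close>, cut off at distance \<open>\<delta>\<close> from the pole.\<close>

definition near_pole :: "real \<Rightarrow> real \<times> real \<Rightarrow> real \<times> real \<Rightarrow> real" where
  "near_pole \<delta> p q = (if norm (p - q) \<le> \<delta> then 1 / norm (p - q) else 0)"

lemma near_pole_nonneg [simp]: "0 \<le> near_pole \<delta> p q"
  by (simp add: near_pole_def)

lemma near_pole_measurable [measurable]: "near_pole \<delta> p \<in> borel_measurable borel"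
  unfolding near_pole_def [abs_def] by measurable

lemma has_integral_abs_powr:
  fixes \<delta> :: real
  assumes "\<delta> \<ge> 0"
  shows "((\<lambda>x. \<bar>x\<bar> powr (- 1 / 2)) has_integral 4 * sqrt \<delta>) {- \<delta>..\<delta>}"
proof -
  have *: "((\<lambda>x. x powr (- 1 / 2)) has_integral 2 * sqrt \<delta>) {0..\<delta>}"
    using has_integral_powr_from_0[of "- 1 / 2" \<delta>] assms by (simp add: powr_half_sqrt mult.commute)
  then have right: "((\<lambda>x. \<bar>x\<bar> powr (- 1 / 2)) has_integral 2 * sqrt \<delta>) {0..\<delta>}"
    by (rule has_integral_eq[rotated]) auto
  then have "((\<lambda>x. \<bar>- x\<bar> powr (- 1 / 2)) has_integral 2 * sqrt \<delta>) {- \<delta>..- 0}"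
    by (rule has_integral_reflect_real[THEN iffD2])
  then have left: "((\<lambda>x. \<bar>x\<bar> powr (- 1 / 2)) has_integral 2 * sqrt \<delta>) {- \<delta>..0}"
    by simp
  have "((\<lambda>x. \<bar>x\<bar> powr (- 1 / 2)) has_integral 2 * sqrt \<delta> + 2 * sqrt \<delta>) {- \<delta>..\<delta>}"
    by (rule has_integral_combine[OF _ _ left right]) (use assms in auto)
  then show ?thesis by simp
qed

lemma nn_integral_abs_powr_shift:
  fixes a \<delta> :: real
  assumes "\<delta> \<ge> 0"
  shows "(\<integral>\<^sup>+ x. ennreal (\<bar>a - x\<bar> powr (- 1 / 2) * indicator {- \<delta>..\<delta>} (a - x)) \<partial>lborel)
    = ennreal (4 * sqrt \<delta>)"
proof -
  have "(\<integral>\<^sup>+ x. ennreal (\<bar>x\<bar> powr (- 1 / 2) * indicator {- \<delta>..\<delta>} x) \<partial>lborel) = ennreal (4 * sqrt \<delta>)"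
    using nn_integral_has_integral_lebesgue[OF _ has_integral_abs_powr[OF assms]]
    by (simp add: mult.commute)
  moreover have "(\<integral>\<^sup>+ x. ennreal (\<bar>x\<bar> powr (- 1 / 2) * indicator {- \<delta>..\<delta>} x) \<partial>lborel)
    = (\<integral>\<^sup>+ x. ennreal (\<bar>a + - 1 * x\<bar> powr (- 1 / 2) * indicator {- \<delta>..\<delta>} (a + - 1 * x)) \<partial>lborel)"
    by (subst nn_integral_real_affine[where c = "- 1" and t = a]) auto
  ultimately show ?thesis by simp
qed

text \<open>By the inequality of the means, \<open>|z|\<^sup>2 \<ge> |x| |y|\<close>, the planar singularity is dominated by a product
  of two integrable singularities on the line. This replaces polar coordinates by Fubini's theorem.\<close>

lemma near_pole_le_product:
  assumes "x \<noteq> fst p" "y \<noteq> snd p"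
  shows "near_pole \<delta> p (x, y) \<le>
    (\<bar>fst p - x\<bar> powr (- 1 / 2) * indicator {- \<delta>..\<delta>} (fst p - x)) *
    (\<bar>snd p - y\<bar> powr (- 1 / 2) * indicator {- \<delta>..\<delta>} (snd p - y))"
proof (cases "norm (p - (x, y)) \<le> \<delta>")
  case True
  define s t where "s = fst p - x" and "t = snd p - y"
  have st: "s \<noteq> 0" "t \<noteq> 0" using assms by (auto simp: s_def t_def)
  have N: "norm (p - (x, y)) = sqrt (s\<^sup>2 + t\<^sup>2)"
    by (cases p) (simp add: norm_Pair s_def t_def)
  have "\<bar>s\<bar> \<le> norm (p - (x, y))" "\<bar>t\<bar> \<le> norm (p - (x, y))"
    unfolding N by (metis real_sqrt_abs real_sqrt_le_iff le_add_same_cancel1 zero_le_power2,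
      metis real_sqrt_abs real_sqrt_le_iff le_add_same_cancel2 zero_le_power2)
  with True have ind: "s \<in> {- \<delta>..\<delta>}" "t \<in> {- \<delta>..\<delta>}" by auto
  have "\<bar>s\<bar> * \<bar>t\<bar> \<le> s\<^sup>2 + t\<^sup>2"
  proof -
    have "2 * (\<bar>s\<bar> * \<bar>t\<bar>) \<le> s\<^sup>2 + t\<^sup>2"
      using sum_squares_bound[of "\<bar>s\<bar>" "\<bar>t\<bar>"] by simp
    moreover have "0 \<le> \<bar>s\<bar> * \<bar>t\<bar>" by simp
    ultimately show ?thesis by linarith
  qed
  then have "sqrt (\<bar>s\<bar> * \<bar>t\<bar>) \<le> sqrt (s\<^sup>2 + t\<^sup>2)" by simp
  then have "1 / sqrt (s\<^sup>2 + t\<^sup>2) \<le> 1 / sqrt (\<bar>s\<bar> * \<bar>t\<bar>)"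
    using st by (intro divide_left_mono mult_pos_pos) (auto simp: sum_power2_gt_zero_iff)
  also have "\<dots> = \<bar>s\<bar> powr (- 1 / 2) * \<bar>t\<bar> powr (- 1 / 2)"
    using st by (simp add: powr_minus_divide powr_half_sqrt real_sqrt_mult)
  finally show ?thesis
    using True ind by (simp add: near_pole_def N flip: s_def t_def)
next
  case False
  then show ?thesis by (simp add: near_pole_def)
qed

text \<open>The bound does not depend on the pole \<open>p\<close> and tends to \<open>0\<close> with \<open>\<delta>\<close>; the first gives the
  finiteness of \<open>\<mu>\<^sub>a\<close>, the second the continuity of the kernel in the mean.\<close>

lemma nn_integral_near_pole_le:
  assumes "\<delta> \<ge> 0"
  shows "(\<integral>\<^sup>+ q. ennreal (near_pole \<delta> p q) \<partial>lborel) \<le> ennreal (16 * \<delta>)"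
proof -
  define s where "s a x = \<bar>a - x\<bar> powr (- 1 / 2) * indicator {- \<delta>..\<delta>} (a - x)" for a x :: real
  have s_nonneg: "0 \<le> s a x" for a x by (simp add: s_def)
  have [measurable]: "s a \<in> borel_measurable borel" for a
    unfolding s_def by measurable
  have int: "(\<integral>\<^sup>+ x. ennreal (s a x) \<partial>lborel) = ennreal (4 * sqrt \<delta>)" for a
    unfolding s_def by (rule nn_integral_abs_powr_shift[OF assms])
  have "(\<integral>\<^sup>+ q. ennreal (near_pole \<delta> p q) \<partial>lborel)
      = (\<integral>\<^sup>+ x. \<integral>\<^sup>+ y. ennreal (near_pole \<delta> p (x, y)) \<partial>lborel \<partial>lborel)"
    by (subst lborel_prod[symmetric], subst lborel.nn_integral_fst[symmetric])
      (simp_all add: lborel_prod)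
  also have "\<dots> \<le> (\<integral>\<^sup>+ x. \<integral>\<^sup>+ y. ennreal (s (fst p) x) * ennreal (s (snd p) y) \<partial>lborel \<partial>lborel)"
  proof (rule nn_integral_mono_AE)
    have "(\<integral>\<^sup>+ y. ennreal (near_pole \<delta> p (x, y)) \<partial>lborel)
        \<le> (\<integral>\<^sup>+ y. ennreal (s (fst p) x) * ennreal (s (snd p) y) \<partial>lborel)" if "x \<noteq> fst p" for x
    proof (rule nn_integral_mono_AE)
      show "AE y in lborel. ennreal (near_pole \<delta> p (x, y)) \<le> ennreal (s (fst p) x) * ennreal (s (snd p) y)"
        using AE_lborel_singleton[of "snd p"]
      proof eventually_elim
        case (elim y)
        show ?case
          using near_pole_le_product[OF that elim, of \<delta>] s_nonneg
          by (simp add: s_def ennreal_mult[symmetric] ennreal_leI)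
      qed
    qed
    then show "AE x in lborel. (\<integral>\<^sup>+ y. ennreal (near_pole \<delta> p (x, y)) \<partial>lborel)
        \<le> (\<integral>\<^sup>+ y. ennreal (s (fst p) x) * ennreal (s (snd p) y) \<partial>lborel)"
      using AE_lborel_singleton[of "fst p"] by (auto elim: eventually_mono)
  qed
  also have "\<dots> = ennreal (4 * sqrt \<delta>) * ennreal (4 * sqrt \<delta>)"
    by (simp add: nn_integral_cmult nn_integral_multc int)
  also have "\<dots> = ennreal (16 * \<delta>)"
    using assms by (simp add: ennreal_mult[symmetric])
  finally show ?thesis .
qed

lemma near_pole_integrable:
  assumes "\<delta> \<ge> 0"
  shows "integrable lebesgue (near_pole \<delta> p)"
proof (rule integrableI_bounded)
  show "near_pole \<delta> p \<in> borel_measurable lebesgue"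
    by (rule measurable_completion) simp
  have "(\<integral>\<^sup>+ q. ennreal (norm (near_pole \<delta> p q)) \<partial>lebesgue) \<le> ennreal (16 * \<delta>)"
    using nn_integral_near_pole_le[OF assms, of p] by (simp add: nn_integral_completion)
  then show "(\<integral>\<^sup>+ q. ennreal (norm (near_pole \<delta> p q)) \<partial>lebesgue) < \<infinity>"
    by (simp add: le_less_trans)
qed

lemma integral_near_pole_le:
  assumes "\<delta> \<ge> 0"
  shows "(LINT q|lebesgue. near_pole \<delta> p q) \<le> 16 * \<delta>"
  using nn_integral_near_pole_le[OF assms, of p] assms
  by (intro integral_real_bounded) (simp_all add: nn_integral_completion)

lemma AE_lebesgue_neq: "AE q in lebesgue. q \<noteq> (p :: 'a :: euclidean_space)"
  by (rule AE_completion) (rule AE_lborel_singleton)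

text \<open>A convolution kernel with at most a singularity of order \<open>1 / |p - q|\<close>, on a compact set of
  arguments. The bound leaves out \<open>p = q\<close>, where the kernel may have any value.\<close>

locale weakly_singular_kernel =
  fixes \<phi> :: "real \<times> real \<Rightarrow> 'b :: euclidean_space" and S :: "(real \<times> real) set" and C :: real
  assumes cont: "continuous_on (- {0}) \<phi>"
    and comp: "compact S"
    and C_nonneg: "C \<ge> 0"
    and bound: "\<And>p q. p \<in> S \<Longrightarrow> q \<in> S \<Longrightarrow> p \<noteq> q \<Longrightarrow> norm (\<phi> (p - q)) \<le> C / norm (p - q)"
begin

lemma kernel_measurable: "(\<lambda>q. \<phi> (p - q)) \<in> borel_measurable lebesgue"
proof (rule measurable_completion)
  have "\<phi> \<in> borel_measurable borel"
    by (rule borel_measurable_continuous_countable_exceptions[of "{0}"]) (use cont in auto)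
  then show "(\<lambda>q. \<phi> (p - q)) \<in> borel_measurable lborel" by measurable
qed

lemma S_lmeasurable: "S \<in> lmeasurable"
  using comp by (rule lmeasurable_compact)

lemma S_sets [measurable]: "S \<in> sets lebesgue"
  using S_lmeasurable by (rule fmeasurableD)

lemma diameter_bound:
  obtains D where "D \<ge> 0" "\<And>p q. p \<in> S \<Longrightarrow> q \<in> S \<Longrightarrow> norm (p - q) \<le> D"
  using diameter_bounded_bound[OF compact_imp_bounded[OF comp]] diameter_ge_0[OF compact_imp_bounded[OF comp]]
  by (auto simp: dist_norm)

lemma kernel_le_near_pole:
  assumes "p \<in> S" "q \<in> S" "q \<noteq> p" "norm (p - q) \<le> \<delta>"
  shows "norm (\<phi> (p - q)) \<le> C * near_pole \<delta> p q"
  using bound[of p q] assms by (auto simp: near_pole_def)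

lemma kernel_integrable:
  assumes p: "p \<in> S"
  shows "set_integrable lebesgue S (\<lambda>q. \<phi> (p - q))"
proof -
  obtain D where D: "D \<ge> 0" "\<And>p q. p \<in> S \<Longrightarrow> q \<in> S \<Longrightarrow> norm (p - q) \<le> D"
    using diameter_bound by blast
  show ?thesis
    unfolding set_integrable_def
  proof (rule Bochner_Integration.integrable_bound)
    show "integrable lebesgue (\<lambda>q. C * near_pole D p q)"
      using near_pole_integrable[OF D(1)] by simp
    show "(\<lambda>q. indicator S q *\<^sub>R \<phi> (p - q)) \<in> borel_measurable lebesgue"
      using kernel_measurable by measurable
    show "AE q in lebesgue. norm (indicator S q *\<^sub>R \<phi> (p - q)) \<le> norm (C * near_pole D p q)"
      using AE_lebesgue_neq[of p]
      by eventually_elim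
        (use kernel_le_near_pole[OF p] D(2)[OF p] C_nonneg in \<open>auto simp: indicator_def\<close>)
  qed
qed

lemma kernel_integral_bounded:
  obtains B where "\<And>p. p \<in> S \<Longrightarrow> (LINT q:S|lebesgue. norm (\<phi> (p - q))) \<le> B"
proof -
  obtain D where D: "D \<ge> 0" "\<And>p q. p \<in> S \<Longrightarrow> q \<in> S \<Longrightarrow> norm (p - q) \<le> D"
    using diameter_bound by blast
  have "(LINT q:S|lebesgue. norm (\<phi> (p - q))) \<le> C * (16 * D)" if p: "p \<in> S" for p
  proof -
    have "(LINT q:S|lebesgue. norm (\<phi> (p - q))) \<le> (LINT q|lebesgue. C * near_pole D p q)"
      unfolding set_lebesgue_integral_def
    proof (rule integral_mono_AE)
      show "integrable lebesgue (\<lambda>q. indicator S q *\<^sub>R norm (\<phi> (p - q)))"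
        using set_integrable_norm[OF kernel_integrable[OF p]] by (simp add: set_integrable_def)
      show "integrable lebesgue (\<lambda>q. C * near_pole D p q)"
        using near_pole_integrable[OF D(1)] by simp
      show "AE q in lebesgue. indicator S q *\<^sub>R norm (\<phi> (p - q)) \<le> C * near_pole D p q"
        using AE_lebesgue_neq[of p]
        by eventually_elim
          (use kernel_le_near_pole[OF p] D(2)[OF p] C_nonneg in \<open>auto simp: indicator_def\<close>)
    qed
    also have "\<dots> \<le> C * (16 * D)"
      using integral_near_pole_le[OF D(1)] C_nonneg by (simp add: mult_left_mono)
    finally show ?thesis .
  qed
  then show ?thesis by (rule that)
qed

text \<open>Translation is continuous in the mean. If \<open>q\<close> is within \<open>2 \<delta>\<close> of \<open>p\<close>, both terms are small in
  integral; otherwise both arguments lie in a compact annulus on which \<open>\<phi>\<close> is uniformly continuous.\<close>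

lemma kernel_L1_continuous:
  assumes "e > 0"
  obtains d where "d > 0" and "\<And>p p'. p \<in> S \<Longrightarrow> p' \<in> S \<Longrightarrow> norm (p - p') < d \<Longrightarrow>
    (LINT q:S|lebesgue. norm (\<phi> (p - q) - \<phi> (p' - q))) < e"
proof -
  obtain D where D: "D \<ge> 0" "\<And>p q. p \<in> S \<Longrightarrow> q \<in> S \<Longrightarrow> norm (p - q) \<le> D"
    using diameter_bound by blast
  define m where "m = measure lebesgue S"
  have m: "m \<ge> 0" by (simp add: m_def)
  \<comment> \<open>chosen so that the two poles, cut off at \<open>3 \<delta>\<close>, contribute at most \<open>2 * C * 16 * 3 \<delta> \<le> e / 2\<close>\<close>
  define \<delta> where "\<delta> = e / (192 * (C + 1))"
  define e' where "e' = e / (4 * (m + 1))"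
  have \<delta>: "\<delta> > 0" using assms C_nonneg by (simp add: \<delta>_def)
  have e': "e' > 0" using assms m by (simp add: e'_def)
  define A where "A = cball 0 D - ball (0::real \<times> real) \<delta>"
  have "compact A"
    unfolding A_def by (intro compact_diff) auto
  moreover have "continuous_on A \<phi>"
    by (rule continuous_on_subset[OF cont]) (use \<delta> in \<open>auto simp: A_def\<close>)
  ultimately have "uniformly_continuous_on A \<phi>"
    using compact_uniformly_continuous by blast
  then obtain d0 where d0: "d0 > 0"
    "\<And>z w. z \<in> A \<Longrightarrow> w \<in> A \<Longrightarrow> dist w z < d0 \<Longrightarrow> dist (\<phi> w) (\<phi> z) < e'"
    unfolding uniformly_continuous_on_def using e' by metis
  show ?thesis
  proof
    show "min d0 \<delta> > 0" using d0 \<delta> by simp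
    fix p p' assume p: "p \<in> S" and p': "p' \<in> S" and pp': "norm (p - p') < min d0 \<delta>"
    have pointwise: "norm (\<phi> (p - q) - \<phi> (p' - q))
        \<le> e' + C * near_pole (3 * \<delta>) p q + C * near_pole (3 * \<delta>) p' q"
      if q: "q \<in> S" "q \<noteq> p" "q \<noteq> p'" for q
    proof (cases "norm (p - q) \<le> 2 * \<delta>")
      case True
      have "norm (p' - q) \<le> norm (p - q) + norm (p - p')"
        using norm_triangle_ineq4[of "p - q" "p - p'"] by simp
      with True pp' have "norm (p' - q) \<le> 3 * \<delta>" by simp
      then have "norm (\<phi> (p' - q)) \<le> C * near_pole (3 * \<delta>) p' q"
        using kernel_le_near_pole p' q by blast
      moreover have "norm (\<phi> (p - q)) \<le> C * near_pole (3 * \<delta>) p q"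
        using kernel_le_near_pole[of p q "3 * \<delta>"] p q True \<delta> by simp
      ultimately show ?thesis
        using norm_triangle_ineq4[of "\<phi> (p - q)" "\<phi> (p' - q)"] e' by linarith
    next
      case False
      have "norm (p - q) \<le> norm (p' - q) + norm (p - p')"
        using norm_triangle_ineq[of "p' - q" "p - p'"] by simp
      with False pp' \<delta> have "p - q \<in> A" "p' - q \<in> A"
        using D(2)[OF p q(1)] D(2)[OF p' q(1)] by (auto simp: A_def)
      then have "norm (\<phi> (p - q) - \<phi> (p' - q)) < e'"
        using d0(2)[of "p' - q" "p - q"] pp' by (simp add: dist_norm)
      moreover have "0 \<le> C * near_pole (3 * \<delta>) p q" "0 \<le> C * near_pole (3 * \<delta>) p' q"
        using C_nonneg by simp_all
      ultimately show ?thesis by linarith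
    qed
    let ?np = "\<lambda>q. C * near_pole (3 * \<delta>) p q + C * near_pole (3 * \<delta>) p' q"
    have np: "integrable lebesgue (\<lambda>q. C * near_pole (3 * \<delta>) r q)" for r
      using near_pole_integrable[of "3 * \<delta>"] \<delta> by simp
    have ind: "integrable lebesgue (\<lambda>q. indicator S q * e')"
      using S_lmeasurable by (simp add: fmeasurable_def)
    have "(LINT q:S|lebesgue. norm (\<phi> (p - q) - \<phi> (p' - q)))
        \<le> (LINT q|lebesgue. indicator S q * e' + ?np q)"
      unfolding set_lebesgue_integral_def
    proof (rule integral_mono_AE)
      show "integrable lebesgue (\<lambda>q. indicator S q *\<^sub>R norm (\<phi> (p - q) - \<phi> (p' - q)))"
        using set_integrable_norm[OF set_integral_diff(1)[OF kernel_integrable[OF p] kernel_integrable[OF p']]]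
        by (simp add: set_integrable_def)
      show "integrable lebesgue (\<lambda>q. indicator S q * e' + ?np q)"
        by (intro Bochner_Integration.integrable_add ind np)
      show "AE q in lebesgue. indicator S q *\<^sub>R norm (\<phi> (p - q) - \<phi> (p' - q)) \<le> indicator S q * e' + ?np q"
        using AE_lebesgue_neq[of p] AE_lebesgue_neq[of p']
        by eventually_elim
          (use pointwise C_nonneg in \<open>auto simp: indicator_def add.assoc intro!: add_nonneg_nonneg\<close>)
    qed
    also have "\<dots> = e' * m + (C * (LINT q|lebesgue. near_pole (3 * \<delta>) p q)
        + C * (LINT q|lebesgue. near_pole (3 * \<delta>) p' q))"
      using np ind by (simp add: m_def)
    also have "\<dots> \<le> e' * m + (C * (16 * (3 * \<delta>)) + C * (16 * (3 * \<delta>)))"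
      using integral_near_pole_le[of "3 * \<delta>"] \<delta> C_nonneg
      by (intro add_mono mult_left_mono order_refl) auto
    also have "\<dots> = e' * m + 96 * C * \<delta>" by simp
    also have "\<dots> < e"
    proof -
      have "e' * m \<le> e / 4"
        using assms m by (simp add: e'_def divide_le_eq field_simps)
      moreover have "96 * C * \<delta> \<le> e / 2"
        using assms C_nonneg by (simp add: \<delta>_def divide_le_eq field_simps)
      ultimately show ?thesis using assms by linarith
    qed
    finally show "(LINT q:S|lebesgue. norm (\<phi> (p - q) - \<phi> (p' - q))) < e" .
  qed
qed

end

section \<open>The 1-norm of vectors and matrices\<close>

definition vec_norm_1 :: "complex^2 \<Rightarrow> real" where
  "vec_norm_1 w = cmod (w $ 1) + cmod (w $ 2)"

lemma vec_norm_1_nonneg [simp]: "0 \<le> vec_norm_1 w"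
  by (simp add: vec_norm_1_def)

lemma vec_norm_1_eq_0_iff [simp]: "vec_norm_1 w = 0 \<longleftrightarrow> w = 0"
  by (auto simp: vec_norm_1_def vec_eq_iff forall_2 add_nonneg_eq_0_iff)

lemma vec_norm_1_add: "vec_norm_1 (w + w') \<le> vec_norm_1 w + vec_norm_1 w'"
  using norm_triangle_ineq[of "w $ 1" "w' $ 1"] norm_triangle_ineq[of "w $ 2" "w' $ 2"]
  by (simp add: vec_norm_1_def)

lemma vec_norm_1_scaleR [simp]: "vec_norm_1 (c *\<^sub>R w) = \<bar>c\<bar> * vec_norm_1 w"
  by (simp add: vec_norm_1_def algebra_simps)

lemma vec_norm_1_smult [simp]: "vec_norm_1 (c *s w) = cmod c * vec_norm_1 w"
  by (simp add: vec_norm_1_def norm_mult algebra_simps)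

lemma norm_le_vec_norm_1: "norm w \<le> vec_norm_1 w"
  unfolding norm_vec_def vec_norm_1_def
  by (rule order_trans[OF L2_set_le_sum]) (simp_all add: sum_2)

lemma vec_norm_1_le_norm: "vec_norm_1 w \<le> 2 * norm w"
  using Finite_Cartesian_Product.norm_nth_le[of w 1] Finite_Cartesian_Product.norm_nth_le[of w 2] by (simp add: vec_norm_1_def)

lemma continuous_on_vec_norm_1 [continuous_intros]:
  "continuous_on A f \<Longrightarrow> continuous_on A (\<lambda>x. vec_norm_1 (f x))"
  unfolding vec_norm_1_def by (intro continuous_intros)

lemma mat_norm_1_2:
  "mat_norm_1 (A :: complex^2^2) = max (cmod (A $ 1 $ 1) + cmod (A $ 2 $ 1)) (cmod (A $ 1 $ 2) + cmod (A $ 2 $ 2))"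
  by (simp add: mat_norm_1_def UNIV_2 image_insert)

lemma mat_norm_1_nonneg [simp]: "0 \<le> mat_norm_1 (A :: complex^2^2)"
  by (simp add: mat_norm_1_2 le_max_iff_disj)

lemma continuous_on_mat_norm_1 [continuous_intros]:
  fixes A :: "'a::topological_space \<Rightarrow> complex^2^2"
  shows "continuous_on X A \<Longrightarrow> continuous_on X (\<lambda>x. mat_norm_1 (A x))"
  unfolding mat_norm_1_2 by (intro continuous_intros)

lemma matrix_vector_mult_2: "((A :: complex^2^2) *v w) $ i = A $ i $ 1 * w $ 1 + A $ i $ 2 * w $ 2"
  by (simp add: matrix_vector_mult_def sum_2)

lemma continuous_on_matrix_vector_mult [continuous_intros]:
  fixes A :: "'a::topological_space \<Rightarrow> complex^2^2"
  assumes "continuous_on X A" "continuous_on X w"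
  shows "continuous_on X (\<lambda>x. A x *v w x)"
  unfolding matrix_vector_mult_def sum_2
  by (intro continuous_intros assms)

lemma continuous_on_smult [continuous_intros]:
  fixes w :: "'a::topological_space \<Rightarrow> complex^2"
  assumes "continuous_on X c" "continuous_on X w"
  shows "continuous_on X (\<lambda>x. c x *s w x)"
  unfolding vector_scalar_mult_def by (intro continuous_intros assms)

lemma borel_measurable_matrix_vector_smult:
  fixes A :: "'a \<Rightarrow> complex^2^2"
  assumes "A \<in> borel_measurable M" "c \<in> borel_measurable M" "w \<in> borel_measurable M"
  shows "(\<lambda>x. A x *v (c x *s w x)) \<in> borel_measurable M"
proof -
  have "(\<lambda>x. c x *s w x) \<in> borel_measurable M"
    by (rule borel_measurable_continuous_Pair[OF assms(2,3)]) (intro continuous_intros)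
  then show ?thesis
    by (rule borel_measurable_continuous_Pair[OF assms(1)]) (intro continuous_intros)
qed

text \<open>The operator bound for the 1-norm is a composition of two inequalities: the triangle inequality in
  each component, and this one. They are kept apart because equality in the composition has to be
  traced back to the triangle inequality.\<close>

lemma vec_norm_1_mult_le_max:
  "cmod (A $ 1 $ 1 * w $ 1) + cmod (A $ 1 $ 2 * w $ 2) + (cmod (A $ 2 $ 1 * w $ 1) + cmod (A $ 2 $ 2 * w $ 2))
    \<le> mat_norm_1 (A :: complex^2^2) * vec_norm_1 w"
proof -
  have "(cmod (A $ 1 $ 1) + cmod (A $ 2 $ 1)) * cmod (w $ 1) \<le> mat_norm_1 A * cmod (w $ 1)"
    "(cmod (A $ 1 $ 2) + cmod (A $ 2 $ 2)) * cmod (w $ 2) \<le> mat_norm_1 A * cmod (w $ 2)"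
    by (intro mult_right_mono; simp add: mat_norm_1_2)+
  then show ?thesis
    by (simp add: vec_norm_1_def norm_mult algebra_simps)
qed

lemma vec_norm_1_mult_le: "vec_norm_1 ((A :: complex^2^2) *v w) \<le> mat_norm_1 A * vec_norm_1 w"
proof -
  have "vec_norm_1 (A *v w) \<le> cmod (A $ 1 $ 1 * w $ 1) + cmod (A $ 1 $ 2 * w $ 2)
      + (cmod (A $ 2 $ 1 * w $ 1) + cmod (A $ 2 $ 2 * w $ 2))"
    unfolding vec_norm_1_def matrix_vector_mult_2 by (intro add_mono norm_triangle_ineq)
  also note vec_norm_1_mult_le_max
  finally show ?thesis .
qed

lemma cmod_entry_le: "cmod ((A :: complex^2^2) $ i $ j) \<le> norm A"
  using Finite_Cartesian_Product.norm_nth_le[of "A $ i" j] Finite_Cartesian_Product.norm_nth_le[of A i] by simp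

lemma mat_norm_1_le_norm: "mat_norm_1 (A :: complex^2^2) \<le> 2 * norm A"
  using cmod_entry_le[of A 1 1] cmod_entry_le[of A 1 2] cmod_entry_le[of A 2 1] cmod_entry_le[of A 2 2]
  by (simp add: mat_norm_1_2)

lemma norm_mat_le_sum: "norm (A :: complex^2^2) \<le> vec_norm_1 (A $ 1) + vec_norm_1 (A $ 2)"
proof -
  have "norm A \<le> norm (A $ 1) + norm (A $ 2)"
    unfolding norm_vec_def[of A] by (rule order_trans[OF L2_set_le_sum]) (simp_all add: sum_2)
  also have "\<dots> \<le> vec_norm_1 (A $ 1) + vec_norm_1 (A $ 2)"
    by (intro add_mono norm_le_vec_norm_1)
  finally show ?thesis .
qed

lemma integrable_vec_norm_1:
  assumes "integrable M w"
  shows "integrable M (\<lambda>q. vec_norm_1 (w q))"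
  unfolding vec_norm_1_def
  by (intro Bochner_Integration.integrable_add integrable_norm
      integrable_bounded_linear[OF bounded_linear_vec_nth] assms)

lemma integral_vec_nth:
  fixes w :: "'a \<Rightarrow> complex^2"
  assumes "integrable M w"
  shows "(LINT q|M. w q $ i) = (LINT q|M. w q) $ i"
  by (rule integral_bounded_linear[OF bounded_linear_vec_nth assms])

lemma vec_norm_1_integral_le:
  assumes "integrable M w"
  shows "vec_norm_1 (LINT q|M. w q) \<le> (LINT q|M. vec_norm_1 (w q))"
proof -
  have int: "integrable M (\<lambda>q. cmod (w q $ i))" for i
    by (intro integrable_norm integrable_bounded_linear[OF bounded_linear_vec_nth] assms)
  have "vec_norm_1 (LINT q|M. w q) = cmod (LINT q|M. w q $ 1) + cmod (LINT q|M. w q $ 2)"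
    by (simp add: vec_norm_1_def integral_vec_nth[OF assms])
  also have "\<dots> \<le> (LINT q|M. cmod (w q $ 1)) + (LINT q|M. cmod (w q $ 2))"
    by (intro add_mono integral_norm_bound)
  also have "\<dots> = (LINT q|M. vec_norm_1 (w q))"
    unfolding vec_norm_1_def by (rule Bochner_Integration.integral_add[OF int int, symmetric])
  finally show ?thesis .
qed

section \<open>The singularity of the Green's function\<close>

text \<open>The second argument \<open>0\<close> makes the Green's function a convolution kernel in one variable.\<close>

lemma green_translation: "green k p q = green k (p - q) 0"
  by (simp add: green_def)

lemma green_entries:
  fixes k :: real
  defines "a r \<equiv> \<i> * hankel1 0 (k * r)" and "b r \<equiv> hankel1 1 (k * r)"
  shows "green k p q $ 1 $ 1 = of_real (k / 4) * (a (norm (p - q)) + b (norm (p - q)) * of_real ((fst p - fst q) / norm (p - q)))"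
    and "green k p q $ 1 $ 2 = of_real (k / 4) * (b (norm (p - q)) * of_real ((snd p - snd q) / norm (p - q)))"
    and "green k p q $ 2 $ 1 = of_real (k / 4) * (b (norm (p - q)) * of_real ((snd p - snd q) / norm (p - q)))"
    and "green k p q $ 2 $ 2 = of_real (k / 4) * (a (norm (p - q)) - b (norm (p - q)) * of_real ((fst p - fst q) / norm (p - q)))"
  by (simp_all add: green_def mat_def beta_mat_def alpha_mat_def a_def b_def
      del: of_real_divide of_real_diff)

lemma continuous_on_green:
  assumes "k > 0"
  shows "continuous_on (- {0}) (\<lambda>z. green k z 0)"
proof -
  have H: "continuous_on (- {0}) (\<lambda>z :: real \<times> real. hankel1 n (k * norm z))" for n
    by (rule continuous_on_compose2[OF continuous_on_hankel1])
      (use assms in \<open>auto simp: zero_less_mult_iff intro!: continuous_intros\<close>)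
  show ?thesis
    unfolding green_def by (intro continuous_intros continuous_on_vec_lambda) (auto intro!: continuous_intros H)
qed

lemma green_bound:
  assumes "k > 0"
  obtains C where "C \<ge> 0" "\<And>z. z \<noteq> 0 \<Longrightarrow> norm z \<le> R \<Longrightarrow> norm (green k z 0) \<le> C / norm z"
proof -
  obtain C0 where C0: "\<And>z. 0 < z \<Longrightarrow> z \<le> k * R \<Longrightarrow> cmod (hankel1 0 z) * z \<le> C0"
    using hankel1_bound[of 0 "k * R"] by auto
  obtain C1 where C1: "\<And>z. 0 < z \<Longrightarrow> z \<le> k * R \<Longrightarrow> cmod (hankel1 1 z) * z \<le> C1"
    using hankel1_bound[of 1 "k * R"] by auto
  define C where "C = \<bar>C0\<bar> + \<bar>C1\<bar>"
  have "norm (green k z 0) \<le> C / norm z" if z: "z \<noteq> 0" "norm z \<le> R" for z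
  proof -
    let ?r = "norm z"
    have r: "?r > 0" using z by simp
    have H: "cmod (hankel1 0 (k * ?r)) \<le> \<bar>C0\<bar> / (k * ?r)" "cmod (hankel1 1 (k * ?r)) \<le> \<bar>C1\<bar> / (k * ?r)"
      using C0[of "k * ?r"] C1[of "k * ?r"] assms r z by (auto simp: pos_le_divide_eq intro: order_trans)
    have dir: "\<bar>fst z / ?r\<bar> \<le> 1" "\<bar>snd z / ?r\<bar> \<le> 1"
      using r norm_fst_le[of "fst z" "snd z"] norm_snd_le[of "snd z" "fst z"] by (auto simp: abs_divide)
    have b: "cmod (hankel1 1 (k * ?r) * of_real c) \<le> cmod (hankel1 1 (k * ?r))" if "\<bar>c\<bar> \<le> 1" for c
      using that by (simp add: norm_mult mult_left_le)
    have "vec_norm_1 (green k z 0 $ 1) + vec_norm_1 (green k z 0 $ 2)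
        \<le> k / 4 * (2 * cmod (hankel1 0 (k * ?r)) + 4 * cmod (hankel1 1 (k * ?r)))"
    proof -
      have e: "cmod (of_real (k / 4) * w) = k / 4 * cmod w" for w
        using assms by (simp add: norm_mult)
      have "cmod (\<i> * hankel1 0 (k * ?r) + hankel1 1 (k * ?r) * of_real (fst z / ?r))
          \<le> cmod (hankel1 0 (k * ?r)) + cmod (hankel1 1 (k * ?r))"
        "cmod (\<i> * hankel1 0 (k * ?r) - hankel1 1 (k * ?r) * of_real (fst z / ?r))
          \<le> cmod (hankel1 0 (k * ?r)) + cmod (hankel1 1 (k * ?r))"
        using norm_triangle_ineq[of "\<i> * hankel1 0 (k * ?r)" "hankel1 1 (k * ?r) * of_real (fst z / ?r)"]
          norm_triangle_ineq4[of "\<i> * hankel1 0 (k * ?r)" "hankel1 1 (k * ?r) * of_real (fst z / ?r)"]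
          b[OF dir(1)] by (simp_all add: norm_mult)
      then have "k / 4 * (cmod (\<i> * hankel1 0 (k * ?r) + hankel1 1 (k * ?r) * of_real (fst z / ?r))
          + cmod (hankel1 1 (k * ?r) * of_real (snd z / ?r))
          + (cmod (hankel1 1 (k * ?r) * of_real (snd z / ?r))
          + cmod (\<i> * hankel1 0 (k * ?r) - hankel1 1 (k * ?r) * of_real (fst z / ?r))))
        \<le> k / 4 * (2 * cmod (hankel1 0 (k * ?r)) + 4 * cmod (hankel1 1 (k * ?r)))"
        using assms b[OF dir(2)] by (intro mult_left_mono) auto
      then show ?thesis
        unfolding vec_norm_1_def green_entries e by (simp add: algebra_simps)
    qed
    also have "\<dots> \<le> k / 4 * (2 * (\<bar>C0\<bar> / (k * ?r)) + 4 * (\<bar>C1\<bar> / (k * ?r)))"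
      using H assms by (intro mult_left_mono add_mono) auto
    also have "\<dots> = (2 * \<bar>C0\<bar> + 4 * \<bar>C1\<bar>) / 4 / ?r"
      using assms r by (simp add: field_simps)
    also have "\<dots> \<le> C / ?r"
      using r by (intro divide_right_mono) (auto simp: C_def)
    finally show ?thesis
      using norm_mat_le_sum[of "green k z 0"] by linarith
  qed
  moreover have "C \<ge> 0" by (simp add: C_def)
  ultimately show ?thesis by (rule that[rotated])
qed

lemma weakly_singular_green:
  assumes "k > 0" "compact S"
  obtains C where "weakly_singular_kernel (\<lambda>z. green k z 0) S C"
proof -
  obtain D where D: "\<And>p q. p \<in> S \<Longrightarrow> q \<in> S \<Longrightarrow> norm (p - q) \<le> D"
    using diameter_bounded_bound[OF compact_imp_bounded[OF assms(2)]] by (auto simp: dist_norm)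
  obtain C where C: "C \<ge> 0" "\<And>z. z \<noteq> 0 \<Longrightarrow> norm z \<le> D \<Longrightarrow> norm (green k z 0) \<le> C / norm z"
    using green_bound[OF assms(1)] by blast
  have "weakly_singular_kernel (\<lambda>z. green k z 0) S C"
    by unfold_locales (use assms C D continuous_on_green in auto)
  then show ?thesis by (rule that)
qed

section \<open>Equality in the triangle inequality\<close>

lemma complex_eq_cmod_if_Re_eq_cmod: "Re z = cmod z \<Longrightarrow> z = of_real (cmod z)"
  using cmod_power2[of z] by (simp add: complex_eq_iff)

text \<open>If \<open>u\<close> is the phase of the integral, then \<open>|w| - Re (cnj u w)\<close> is nonnegative and has integral
  \<open>0\<close>.\<close>

lemma integral_norm_eq_imp_constant_phase:
  fixes w :: "'a \<Rightarrow> complex"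
  assumes w: "integrable M w" and eq: "cmod (LINT x|M. w x) = (LINT x|M. cmod (w x))"
  obtains u where "AE x in M. w x = u * of_real (cmod (w x))"
proof -
  define I where "I = (LINT x|M. w x)"
  \<comment> \<open>if the integral is \<open>0\<close>, then \<open>w\<close> vanishes almost everywhere and any phase will do\<close>
  define u where "u = (if I = 0 then 1 else sgn I)"
  have u: "u * cnj u = 1" "cmod u = 1"
    by (auto simp: u_def complex_norm_square[symmetric] norm_sgn)
  have cw: "integrable M (\<lambda>x. cnj u * w x)" using w by simp
  have "cnj u * I = of_real (cmod I)"
  proof (cases "I = 0")
    case False
    then have "I = u * of_real (cmod I)" by (simp add: u_def sgn_eq)
    then have "cnj u * I = (u * cnj u) * of_real (cmod I)" by (metis mult.assoc mult.commute)
    then show ?thesis by (simp add: u)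
  qed (simp add: u_def)
  then have "Re (LINT x|M. cnj u * w x) = (LINT x|M. cmod (w x))"
    using eq by (simp add: I_def[symmetric])
  then have "(LINT x|M. cmod (w x) - Re (cnj u * w x)) = 0"
    using w cw by (simp add: integral_Re del: times_complex.simps)
  moreover have le: "Re (cnj u * w x) \<le> cmod (w x)" for x
    using complex_Re_le_cmod[of "cnj u * w x"] u by (simp add: norm_mult del: times_complex.simps)
  moreover have "integrable M (\<lambda>x. cmod (w x) - Re (cnj u * w x))"
    using w cw by (intro Bochner_Integration.integrable_diff integrable_norm integrable_Re)
  ultimately have "AE x in M. cmod (w x) - Re (cnj u * w x) = 0"
    by (subst (asm) integral_nonneg_eq_0_iff_AE) (auto simp del: times_complex.simps)
  then have "AE x in M. w x = u * of_real (cmod (w x))"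
  proof eventually_elim
    case (elim x)
    have "cmod (cnj u * w x) = cmod (w x)" using u by (simp add: norm_mult)
    with elim have "Re (cnj u * w x) = cmod (cnj u * w x)" by linarith
    then have "cnj u * w x = of_real (cmod (cnj u * w x))"
      by (rule complex_eq_cmod_if_Re_eq_cmod)
    then have "cnj u * w x = of_real (cmod (w x))"
      using \<open>cmod (cnj u * w x) = cmod (w x)\<close> by simp
    then have "u * of_real (cmod (w x)) = (u * cnj u) * w x" by (metis mult.assoc)
    then show ?case by (simp add: u)
  qed
  then show ?thesis by (rule that)
qed

lemma AE_imp_everywhere_on_open:
  fixes F :: "'a::euclidean_space \<Rightarrow> 'b::real_normed_vector"
  assumes "open W" "continuous_on W F" "AE q in lebesgue. q \<in> W \<longrightarrow> F q = 0" "q \<in> W"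
  shows "F q = 0"
proof (rule ccontr)
  assume "F q \<noteq> 0"
  have "{x \<in> W. F x \<noteq> 0} = W \<inter> F -` (- {0})" by auto
  then have "open {x \<in> W. F x \<noteq> 0}"
    using continuous_open_preimage[OF assms(2,1), of "- {0}"] by (simp only:) auto
  moreover have "negligible {x \<in> W. F x \<noteq> 0}"
  proof -
    obtain N where "N \<in> null_sets lebesgue" "{x. \<not> (x \<in> W \<longrightarrow> F x = 0)} \<subseteq> N"
      using assms(3) by (auto simp: eventually_ae_filter)
    then show ?thesis
      using negligible_subset[of N "{x \<in> W. F x \<noteq> 0}"] by (auto simp: negligible_iff_null_sets)
  qed
  ultimately show False
    using open_not_negligible \<open>F q \<noteq> 0\<close> assms(4) by blast
qed

text \<open>By the parallelogram law.\<close>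

lemma zero_if_norm_add_diff_eq:
  fixes x y :: complex
  assumes "cmod (x + y) = cmod x + cmod y" "cmod (x - y) = cmod x + cmod y"
  shows "x = 0 \<or> y = 0"
proof -
  have "(cmod (x + y))\<^sup>2 + (cmod (x - y))\<^sup>2 = 2 * (cmod x)\<^sup>2 + 2 * (cmod y)\<^sup>2"
    unfolding cmod_power2 by (simp add: power2_eq_square algebra_simps)
  then have "4 * (cmod x * cmod y) = 0"
    unfolding assms by (simp add: power2_eq_square algebra_simps)
  then show ?thesis by simp
qed

text \<open>Attaining the matrix norm means equality in the triangle inequality in each row, that is, the two
  products in the row have equal phase. Changing the sign of the off-diagonal entries turns equal
  phases into opposite ones, so one of the products has to vanish.\<close>

lemma diagonal_zero_if_norm_attained:
  fixes A A' :: "complex^2^2" and g :: "complex^2"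
  assumes A: "vec_norm_1 (A *v g) = mat_norm_1 A * vec_norm_1 g"
    and A': "vec_norm_1 (A' *v g) = mat_norm_1 A' * vec_norm_1 g"
    and diag: "A' $ 1 $ 1 = A $ 1 $ 1" "A' $ 2 $ 2 = A $ 2 $ 2"
    and off: "A' $ 1 $ 2 = - A $ 1 $ 2" "A' $ 2 $ 1 = - A $ 2 $ 1" "A $ 1 $ 2 \<noteq> 0" "A $ 2 $ 1 \<noteq> 0"
    and g: "g $ 1 \<noteq> 0" "g $ 2 \<noteq> 0"
  shows "A $ 1 $ 1 = 0" "A $ 2 $ 2 = 0"
proof -
  have split: "cmod (M $ i $ 1 * g $ 1 + M $ i $ 2 * g $ 2) = cmod (M $ i $ 1 * g $ 1) + cmod (M $ i $ 2 * g $ 2)"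
    if "vec_norm_1 (M *v g) = mat_norm_1 M * vec_norm_1 g" for M :: "complex^2^2" and i
  proof -
    have t: "cmod (M $ j $ 1 * g $ 1 + M $ j $ 2 * g $ 2) \<le> cmod (M $ j $ 1 * g $ 1) + cmod (M $ j $ 2 * g $ 2)" for j
      by (rule norm_triangle_ineq)
    have "i = 1 \<or> i = 2" using exhaust_2 by auto
    then show ?thesis
      using that vec_norm_1_mult_le_max[of M g] t[of 1] t[of 2]
      by (auto simp: vec_norm_1_def[of "M *v g"] matrix_vector_mult_2)
  qed
  show "A $ 1 $ 1 = 0"
    using zero_if_norm_add_diff_eq[of "A $ 1 $ 1 * g $ 1" "A $ 1 $ 2 * g $ 2"]
      split[OF A, of 1] split[OF A', of 1] diag off g by auto
  show "A $ 2 $ 2 = 0"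
    using zero_if_norm_add_diff_eq[of "A $ 2 $ 2 * g $ 2" "A $ 2 $ 1 * g $ 1"]
      split[OF A, of 2] split[OF A', of 2] diag off g by (auto simp: add.commute)
qed

section \<open>The Lippmann--Schwinger operator\<close>

locale green_domain =
  fixes k :: real and S :: "(real \<times> real) set"
  assumes k_pos: "k > 0" and S_compact: "compact S" and S_nonempty: "S \<noteq> {}"
begin

lemma green_kernel:
  obtains C where "weakly_singular_kernel (\<lambda>z. green k z 0) S C"
  using weakly_singular_green[OF k_pos S_compact] .

text \<open>The left-hand side matches inside the right-hand side, so this is used for a single rewriting
  step only.\<close>

lemma green_eq_translate: "green k p = (\<lambda>q. green k (p - q) 0)"
  by (rule ext) (rule green_translation)

lemma green_integrable:
  assumes "p \<in> S"
  shows "set_integrable lebesgue S (green k p)"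
proof -
  obtain C where "weakly_singular_kernel (\<lambda>z. green k z 0) S C"
    using green_kernel .
  from weakly_singular_kernel.kernel_integrable[OF this assms] show ?thesis
    by (subst green_eq_translate)
qed

lemma green_measurable: "green k p \<in> borel_measurable lebesgue"
proof -
  obtain C where "weakly_singular_kernel (\<lambda>z. green k z 0) S C"
    using green_kernel .
  from weakly_singular_kernel.kernel_measurable[OF this] show ?thesis
    by (subst green_eq_translate)
qed

lemma S_sets: "S \<in> sets lebesgue"
  using S_compact by (intro fmeasurableD lmeasurable_compact)

lemma mat_norm_1_green_integrable:
  assumes "p \<in> S"
  shows "set_integrable lebesgue S (\<lambda>q. mat_norm_1 (green k p q))"
proof (rule set_integrable_bound)
  show "set_integrable lebesgue S (\<lambda>q. 2 * norm (green k p q))"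
    using set_integrable_norm[OF green_integrable[OF assms]] by simp
  have "(\<lambda>q. mat_norm_1 (green k p q)) \<in> borel_measurable lebesgue"
    by (rule borel_measurable_continuous_on[OF _ green_measurable]) (intro continuous_intros)
  then show "set_borel_measurable lebesgue S (\<lambda>q. mat_norm_1 (green k p q))"
    unfolding set_borel_measurable_def
    by (intro borel_measurable_scaleR borel_measurable_indicator S_sets)
  show "AE q in lebesgue. q \<in> S \<longrightarrow> norm (mat_norm_1 (green k p q)) \<le> norm (2 * norm (green k p q))"
    using mat_norm_1_le_norm by auto
qed

text \<open>The supremum in the definition of \<open>\<mu>\<^sub>a\<close> is one of real numbers, so it is an upper bound only
  because the integrals are bounded.\<close>

lemma mu_bound:
  assumes p: "p \<in> S"
  shows "k * (LINT q:S|lebesgue. mat_norm_1 (green k p q)) \<le> mu_a k S"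
proof -
  obtain C where C: "weakly_singular_kernel (\<lambda>z. green k z 0) S C"
    using green_kernel .
  obtain B where B: "\<And>p. p \<in> S \<Longrightarrow> (LINT q:S|lebesgue. norm (green k (p - q) 0)) \<le> B"
    using weakly_singular_kernel.kernel_integral_bounded[OF C] by blast
  have "(LINT q:S|lebesgue. mat_norm_1 (green k p q)) \<le> 2 * B" if "p \<in> S" for p
  proof -
    have "(LINT q:S|lebesgue. mat_norm_1 (green k p q)) \<le> (LINT q:S|lebesgue. 2 * norm (green k p q))"
      using set_integrable_norm[OF green_integrable[OF that]]
      by (intro set_integral_mono mat_norm_1_green_integrable that mat_norm_1_le_norm) auto
    then show ?thesis
      using B[OF that] by (simp add: green_translation[of k p, symmetric])
  qed
  then have "bdd_above ((\<lambda>p. LINT q:S|lebesgue. mat_norm_1 (green k p q)) ` S)"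
    by (rule bdd_aboveI2)
  then show ?thesis
    unfolding mu_a_def using k_pos p by (intro mult_left_mono cSUP_upper) auto
qed

lemma mu_nonneg: "0 \<le> mu_a k S"
proof -
  obtain p where p: "p \<in> S" using S_nonempty by blast
  have "0 \<le> k * (LINT q:S|lebesgue. mat_norm_1 (green k p q))"
    using k_pos by (simp add: set_lebesgue_integral_def)
  also have "\<dots> \<le> mu_a k S" by (rule mu_bound[OF p])
  finally show ?thesis .
qed

end

text \<open>The bound \<open>v\<close> stands for \<open>1 / \<mu>\<^sub>a\<close>; the form \<open>v * mu_a k S \<le> 1\<close> also covers the degenerate case
  \<open>\<mu>\<^sub>a = 0\<close>, where the quotient is \<open>0\<close> by convention. That every point of \<open>S\<close> is a limit of
  interior points provides the open set on which the equality case is refuted.\<close>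

locale dirac_scattering = green_domain k S
  for k :: real and S :: "(real \<times> real) set" +
  fixes v :: real and V :: "real \<times> real \<Rightarrow> complex"
  assumes S_regular: "S \<subseteq> closure (interior S)"
    and V_measurable: "V \<in> borel_measurable lebesgue"
    and V_bound: "AE q in lebesgue. q \<in> S \<longrightarrow> cmod (V q) \<le> v"
    and v_nonneg: "v \<ge> 0"
    and v_mu: "v * mu_a k S \<le> 1"
begin

definition K :: "(real \<times> real \<Rightarrow> complex^2) \<Rightarrow> real \<times> real \<Rightarrow> complex^2" where
  "K f p = - k *\<^sub>R (LINT q:S|lebesgue. green k p q *v (V q *s f q))"

definition contS :: "(real \<times> real \<Rightarrow> complex^2) set" where
  "contS = {f. continuous_on S f}"

lemma attains_max:
  assumes "f \<in> contS"
  obtains p where "p \<in> S" "\<forall>q\<in>S. vec_norm_1 (f q) \<le> vec_norm_1 (f p)"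
proof -
  have "continuous_on S (\<lambda>q. vec_norm_1 (f q))"
    using assms by (auto simp: contS_def intro!: continuous_intros)
  then show ?thesis
    using continuous_attains_sup[OF S_compact S_nonempty] that by blast
qed

lemma bounded_if_cont:
  assumes "f \<in> contS"
  obtains M where "M \<ge> 0" "\<forall>q\<in>S. vec_norm_1 (f q) \<le> M"
  using attains_max[OF assms] vec_norm_1_nonneg by metis

lemma scattered_measurable:
  fixes A :: "real \<times> real \<Rightarrow> complex^2^2"
  assumes "A \<in> borel_measurable lebesgue" "f \<in> contS"
  shows "(\<lambda>q. indicator S q *\<^sub>R (A q *v (V q *s f q))) \<in> borel_measurable lebesgue"
proof -
  have "(\<lambda>q. indicator S q *\<^sub>R f q) \<in> borel_measurable borel"
    using assms S_compact
    by (intro borel_measurable_continuous_on_indicator) (auto simp: contS_def compact_imp_closed)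
  then have "(\<lambda>q. indicator S q *\<^sub>R f q) \<in> borel_measurable lebesgue"
    by (intro measurable_completion) simp
  from borel_measurable_matrix_vector_smult[OF assms(1) V_measurable this]
  show ?thesis
    by (rule measurable_cong[THEN iffD1, rotated])
      (auto simp: vec_eq_iff matrix_vector_mult_2 forall_2 indicator_def)
qed

lemma scattered_bound:
  fixes A :: "real \<times> real \<Rightarrow> complex^2^2"
  assumes "\<forall>q\<in>S. vec_norm_1 (f q) \<le> M"
  shows "AE q in lebesgue. q \<in> S \<longrightarrow> vec_norm_1 (A q *v (V q *s f q)) \<le> mat_norm_1 (A q) * (v * M)"
  using V_bound
proof eventually_elim
  case (elim q)
  show ?case
  proof
    assume q: "q \<in> S"
    have "vec_norm_1 (A q *v (V q *s f q)) \<le> mat_norm_1 (A q) * (cmod (V q) * vec_norm_1 (f q))"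
      using vec_norm_1_mult_le[of "A q" "V q *s f q"] by simp
    also have "\<dots> \<le> mat_norm_1 (A q) * (v * M)"
      using elim q assms v_nonneg by (intro mult_left_mono mult_mono) auto
    finally show "vec_norm_1 (A q *v (V q *s f q)) \<le> mat_norm_1 (A q) * (v * M)" .
  qed
qed

lemma scattered_integrable:
  fixes A :: "real \<times> real \<Rightarrow> complex^2^2"
  assumes A: "set_integrable lebesgue S A" "A \<in> borel_measurable lebesgue" and f: "f \<in> contS"
  shows "set_integrable lebesgue S (\<lambda>q. A q *v (V q *s f q))"
proof -
  obtain M where M: "M \<ge> 0" "\<forall>q\<in>S. vec_norm_1 (f q) \<le> M"
    using bounded_if_cont[OF f] by blast
  show ?thesis
  proof (rule set_integrable_bound)
    show "set_integrable lebesgue S (\<lambda>q. 2 * v * M * norm (A q))"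
      using set_integrable_norm[OF A(1)] by simp
    show "set_borel_measurable lebesgue S (\<lambda>q. A q *v (V q *s f q))"
      using scattered_measurable[OF A(2) f] by (simp add: set_borel_measurable_def)
    show "AE q in lebesgue. q \<in> S \<longrightarrow> norm (A q *v (V q *s f q)) \<le> norm (2 * v * M * norm (A q))"
      using scattered_bound[where f = f and A = A, OF M(2)]
    proof eventually_elim
      case (elim q)
      have "mat_norm_1 (A q) * (v * M) \<le> 2 * norm (A q) * (v * M)"
        using mat_norm_1_le_norm v_nonneg M(1) by (intro mult_right_mono) auto
      then show ?case
        using elim norm_le_vec_norm_1[of "A q *v (V q *s f q)"] v_nonneg M(1)
        by (auto simp: abs_mult mult_ac)
    qed
  qed
qed

lemma K_integrable:
  assumes "p \<in> S" "f \<in> contS"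
  shows "set_integrable lebesgue S (\<lambda>q. green k p q *v (V q *s f q))"
  using scattered_integrable green_integrable green_measurable assms by blast

lemma K_cong: "(\<And>q. q \<in> S \<Longrightarrow> f q = g q) \<Longrightarrow> K f p = K g p"
  unfolding K_def set_lebesgue_integral_def
  by (intro arg_cong[where f = "(*\<^sub>R) (- k)"] Bochner_Integration.integral_cong) (auto simp: indicator_def)

lemma K_add:
  assumes "p \<in> S" "f \<in> contS" "g \<in> contS"
  shows "K (\<lambda>q. f q + g q) p = K f p + K g p"
proof -
  have "green k p q *v (V q *s (f q + g q)) = green k p q *v (V q *s f q) + green k p q *v (V q *s g q)" for q
    by (simp add: vec_eq_iff matrix_vector_mult_2 algebra_simps)
  then show ?thesis
    unfolding K_def using K_integrable assms by (simp add: scaleR_add_right)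
qed

lemma K_scaleR: "K (\<lambda>q. c *\<^sub>R f q) p = c *\<^sub>R K f p"
proof -
  have "green k p q *v (V q *s (c *\<^sub>R f q)) = c *\<^sub>R (green k p q *v (V q *s f q))" for q
    by (simp add: vec_eq_iff matrix_vector_mult_2 algebra_simps)
  then show ?thesis
    unfolding K_def by (simp add: mult.commute)
qed

lemma contS_diff: "f \<in> contS \<Longrightarrow> g \<in> contS \<Longrightarrow> (\<lambda>q. f q - g q) \<in> contS"
  and contS_scaleR: "f \<in> contS \<Longrightarrow> (\<lambda>q. c *\<^sub>R f q) \<in> contS"
  by (auto simp: contS_def intro!: continuous_intros)

lemma K_diff:
  assumes "p \<in> S" "f \<in> contS" "g \<in> contS"
  shows "K (\<lambda>q. f q - g q) p = K f p - K g p"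
proof -
  have "K f p = K (\<lambda>q. (f q - g q) + g q) p" by simp
  also have "\<dots> = K (\<lambda>q. f q - g q) p + K g p"
    using assms by (intro K_add contS_diff) auto
  finally show ?thesis by simp
qed

lemma vec_norm_1_K_le:
  assumes p: "p \<in> S" and f: "f \<in> contS"
  shows "vec_norm_1 (K f p) \<le> k * (LINT q:S|lebesgue. vec_norm_1 (green k p q *v (V q *s f q)))"
proof -
  have "vec_norm_1 (K f p) = k * vec_norm_1 (LINT q|lebesgue. indicator S q *\<^sub>R (green k p q *v (V q *s f q)))"
    using k_pos unfolding K_def vec_norm_1_scaleR by (simp add: set_lebesgue_integral_def)
  also have "\<dots> \<le> k * (LINT q|lebesgue. vec_norm_1 (indicator S q *\<^sub>R (green k p q *v (V q *s f q))))"
    using k_pos K_integrable[OF p f]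
    by (intro mult_left_mono vec_norm_1_integral_le) (auto simp: set_integrable_def)
  also have "\<dots> = k * (LINT q:S|lebesgue. vec_norm_1 (green k p q *v (V q *s f q)))"
    by (simp add: set_lebesgue_integral_def)
  finally show ?thesis .
qed

lemma scattered_norm_integrable:
  assumes "p \<in> S" "f \<in> contS"
  shows "set_integrable lebesgue S (\<lambda>q. vec_norm_1 (green k p q *v (V q *s f q)))"
  using integrable_vec_norm_1[OF K_integrable[OF assms, unfolded set_integrable_def]]
  by (simp add: set_integrable_def)

lemma scattered_integral_le:
  assumes p: "p \<in> S" and f: "f \<in> contS" and M: "\<forall>q\<in>S. vec_norm_1 (f q) \<le> M"
  shows "(LINT q:S|lebesgue. vec_norm_1 (green k p q *v (V q *s f q)))
    \<le> (LINT q:S|lebesgue. mat_norm_1 (green k p q)) * (v * M)"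
proof -
  have "(LINT q:S|lebesgue. vec_norm_1 (green k p q *v (V q *s f q)))
      \<le> (LINT q:S|lebesgue. mat_norm_1 (green k p q) * (v * M))"
    using scattered_bound[where f = f and A = "green k p", OF M]
    by (intro set_integral_mono_AE scattered_norm_integrable p f set_integrable_mult_left
        mat_norm_1_green_integrable) (auto elim: eventually_mono)
  then show ?thesis by simp
qed

text \<open>The inequality \<open>\<parallel>K\<parallel> \<le> v \<mu>\<^sub>a \<le> 1\<close>.\<close>

lemma K_bound:
  assumes p: "p \<in> S" and f: "f \<in> contS" and M: "\<forall>q\<in>S. vec_norm_1 (f q) \<le> M"
  shows "vec_norm_1 (K f p) \<le> M"
proof -
  have "M \<ge> 0" using M p vec_norm_1_nonneg[of "f p"] by (meson order_trans)
  have "vec_norm_1 (K f p) \<le> k * ((LINT q:S|lebesgue. mat_norm_1 (green k p q)) * (v * M))"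
    using vec_norm_1_K_le[OF p f] scattered_integral_le[OF p f M] k_pos
    by (meson mult_left_mono order_trans less_imp_le)
  also have "\<dots> = (v * (k * (LINT q:S|lebesgue. mat_norm_1 (green k p q)))) * M"
    by simp
  also have "\<dots> \<le> (v * mu_a k S) * M"
    using mu_bound[OF p] v_nonneg \<open>M \<ge> 0\<close> by (intro mult_right_mono mult_left_mono) auto
  also have "\<dots> \<le> 1 * M"
    using v_mu \<open>M \<ge> 0\<close> by (rule mult_right_mono)
  finally show ?thesis by simp
qed

text \<open>The modulus of continuity depends on \<open>f\<close> only through its bound, which makes \<open>K\<close> compact.\<close>

lemma K_equicontinuous:
  assumes "e > 0"
  obtains d where "d > 0"
    "\<And>f p p'. f \<in> contS \<Longrightarrow> (\<forall>q\<in>S. vec_norm_1 (f q) \<le> M) \<Longrightarrow> p \<in> S \<Longrightarrow> p' \<in> S \<Longrightarrow>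
      norm (p - p') < d \<Longrightarrow> norm (K f p - K f p') < e"
proof -
  obtain C where C: "weakly_singular_kernel (\<lambda>z. green k z 0) S C"
    using green_kernel .
  define c where "c = k * (2 * (v * \<bar>M\<bar>))"
  have c: "c \<ge> 0" using k_pos v_nonneg by (simp add: c_def)
  have "e / (c + 1) > 0" using assms c by simp
  then obtain d where d: "d > 0" "\<And>p p'. p \<in> S \<Longrightarrow> p' \<in> S \<Longrightarrow> norm (p - p') < d \<Longrightarrow>
    (LINT q:S|lebesgue. norm (green k (p - q) 0 - green k (p' - q) 0)) < e / (c + 1)"
    by (rule weakly_singular_kernel.kernel_L1_continuous[OF C]) blast
  show ?thesis
  proof (rule that[OF d(1)])
    fix f p p'
    assume f: "f \<in> contS" and M: "\<forall>q\<in>S. vec_norm_1 (f q) \<le> M"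
      and p: "p \<in> S" and p': "p' \<in> S" and close: "norm (p - p') < d"
    let ?D = "\<lambda>q. green k p q - green k p' q"
    have M': "\<forall>q\<in>S. vec_norm_1 (f q) \<le> \<bar>M\<bar>" using M by force
    have D_int: "set_integrable lebesgue S ?D"
      using green_integrable p p' by (intro set_integral_diff)
    have D_meas: "?D \<in> borel_measurable lebesgue"
      using green_measurable by (intro borel_measurable_diff)
    have DV_int: "set_integrable lebesgue S (\<lambda>q. ?D q *v (V q *s f q))"
      by (rule scattered_integrable[OF D_int D_meas f])
    have "?D q *v (V q *s f q) = green k p q *v (V q *s f q) - green k p' q *v (V q *s f q)" for q
      by (simp add: vec_eq_iff matrix_vector_mult_2 algebra_simps)
    then have "K f p - K f p' = - k *\<^sub>R (LINT q:S|lebesgue. ?D q *v (V q *s f q))"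
      unfolding K_def using K_integrable[OF p f] K_integrable[OF p' f]
      by (simp add: scaleR_diff_right)
    then have "norm (K f p - K f p') = k * norm (LINT q:S|lebesgue. ?D q *v (V q *s f q))"
      using k_pos by simp
    also have "\<dots> \<le> k * (LINT q:S|lebesgue. norm (?D q *v (V q *s f q)))"
      using k_pos DV_int by (intro mult_left_mono set_integral_norm_bound) auto
    also have "\<dots> \<le> k * (LINT q:S|lebesgue. norm (?D q) * (2 * (v * \<bar>M\<bar>)))"
    proof (rule mult_left_mono[OF set_integral_mono_AE])
      show "set_integrable lebesgue S (\<lambda>q. norm (?D q *v (V q *s f q)))"
        using DV_int by (rule set_integrable_norm)
      show "set_integrable lebesgue S (\<lambda>q. norm (?D q) * (2 * (v * \<bar>M\<bar>)))"
        using set_integrable_norm[OF D_int] by (rule set_integrable_mult_left)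
      show "AE q\<in>S in lebesgue. norm (?D q *v (V q *s f q)) \<le> norm (?D q) * (2 * (v * \<bar>M\<bar>))"
        using scattered_bound[where f = f and A = ?D, OF M']
      proof eventually_elim
        case (elim q)
        have "mat_norm_1 (?D q) * (v * \<bar>M\<bar>) \<le> 2 * norm (?D q) * (v * \<bar>M\<bar>)"
          using mat_norm_1_le_norm v_nonneg by (intro mult_right_mono) auto
        then show ?case
          using elim norm_le_vec_norm_1[of "?D q *v (V q *s f q)"] by (auto simp: mult_ac)
      qed
    qed (use k_pos in simp)
    also have "\<dots> = c * (LINT q:S|lebesgue. norm (?D q))"
      by (simp add: c_def)
    also have "\<dots> \<le> c * (e / (c + 1))"
      using d(2)[OF p p' close] c
      by (intro mult_left_mono) (simp_all add: green_translation[of k p] green_translation[of k p'])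
    also have "\<dots> < e"
      using assms c by (simp add: field_simps)
    finally show "norm (K f p - K f p') < e" .
  qed
qed

lemma K_cont:
  assumes f: "f \<in> contS"
  shows "K f \<in> contS"
  unfolding contS_def mem_Collect_eq continuous_on_iff
proof (intro ballI allI impI)
  fix p and e :: real assume "p \<in> S" "e > 0"
  obtain M where M: "\<forall>q\<in>S. vec_norm_1 (f q) \<le> M"
    using bounded_if_cont[OF f] by blast
  show "\<exists>d>0. \<forall>p'\<in>S. dist p' p < d \<longrightarrow> dist (K f p') (K f p) < e"
  proof (rule K_equicontinuous[OF \<open>e > 0\<close>, of M])
    fix d
    assume "d > 0" and d: "\<And>f p p'. f \<in> contS \<Longrightarrow> (\<forall>q\<in>S. vec_norm_1 (f q) \<le> M) \<Longrightarrow> p \<in> S \<Longrightarrow>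
      p' \<in> S \<Longrightarrow> norm (p - p') < d \<Longrightarrow> norm (K f p - K f p') < e"
    have "norm (K f p' - K f p) < e" if "p' \<in> S" "norm (p' - p) < d" for p'
      by (rule d[OF f]) (use M that \<open>p \<in> S\<close> in auto)
    with \<open>d > 0\<close> show ?thesis
      by (auto simp: dist_norm)
  qed
qed

text \<open>The bound on \<open>K g p\<close> is a chain of three inequalities: the integral against the integral of the
  norm, in each component; the operator norm; and the definition of \<open>\<mu>\<^sub>a\<close>. If \<open>K g p\<close> has norm 1, none of
  them loses anything, which gives the phases \<open>u1\<close>, \<open>u2\<close> and the equality almost everywhere.\<close>

lemma K_equality:
  assumes p: "p \<in> S" and g: "g \<in> contS" and g1: "\<forall>q\<in>S. vec_norm_1 (g q) \<le> 1"
    and eq: "vec_norm_1 (K g p) = 1"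
  obtains u1 u2 where "v > 0"
    "AE q in lebesgue. q \<in> S \<longrightarrow> vec_norm_1 (green k p q *v (V q *s g q)) = mat_norm_1 (green k p q) * v"
    "AE q in lebesgue. q \<in> S \<longrightarrow> (green k p q *v (V q *s g q)) $ 1 = u1 * of_real (cmod ((green k p q *v (V q *s g q)) $ 1))"
    "AE q in lebesgue. q \<in> S \<longrightarrow> (green k p q *v (V q *s g q)) $ 2 = u2 * of_real (cmod ((green k p q *v (V q *s g q)) $ 2))"
proof -
  define w where "w q = indicator S q *\<^sub>R (green k p q *v (V q *s g q))" for q
  define I where "I = (LINT q:S|lebesgue. mat_norm_1 (green k p q))"
  have w: "integrable lebesgue w"
    using K_integrable[OF p g] by (simp add: set_integrable_def w_def [abs_def])
  have wi: "integrable lebesgue (\<lambda>q. w q $ i)" for i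
    by (rule integrable_bounded_linear[OF bounded_linear_vec_nth w])
  have Kw: "vec_norm_1 (K g p) = k * (cmod (LINT q|lebesgue. w q $ 1) + cmod (LINT q|lebesgue. w q $ 2))"
    using k_pos unfolding K_def vec_norm_1_scaleR
    by (simp add: set_lebesgue_integral_def w_def[symmetric] vec_norm_1_def integral_vec_nth[OF w])
  have n1: "(LINT q|lebesgue. vec_norm_1 (w q)) = (LINT q|lebesgue. cmod (w q $ 1)) + (LINT q|lebesgue. cmod (w q $ 2))"
    unfolding vec_norm_1_def by (intro Bochner_Integration.integral_add integrable_norm wi)
  have n1_set: "(LINT q|lebesgue. vec_norm_1 (w q)) = (LINT q:S|lebesgue. vec_norm_1 (green k p q *v (V q *s g q)))"
    by (simp add: w_def set_lebesgue_integral_def)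
  have le1: "cmod (LINT q|lebesgue. w q $ i) \<le> (LINT q|lebesgue. cmod (w q $ i))" for i
    by (rule integral_norm_bound)
  have le2: "(LINT q|lebesgue. vec_norm_1 (w q)) \<le> I * v"
    using scattered_integral_le[OF p g g1] by (simp add: n1_set I_def)
  have le3: "k * (I * v) \<le> 1"
  proof -
    have "v * (k * I) \<le> v * mu_a k S"
      using mu_bound[OF p] v_nonneg by (intro mult_left_mono) (simp_all add: I_def)
    with v_mu show ?thesis by (simp add: mult_ac)
  qed
  have "k * (cmod (LINT q|lebesgue. w q $ 1) + cmod (LINT q|lebesgue. w q $ 2)) \<ge> k * (I * v)"
    using Kw eq le3 by simp
  then have ge: "cmod (LINT q|lebesgue. w q $ 1) + cmod (LINT q|lebesgue. w q $ 2) \<ge> I * v"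
    using k_pos by simp
  have eq1: "cmod (LINT q|lebesgue. w q $ 1) = (LINT q|lebesgue. cmod (w q $ 1))"
    and eq2: "cmod (LINT q|lebesgue. w q $ 2) = (LINT q|lebesgue. cmod (w q $ 2))"
    and eqI: "(LINT q|lebesgue. vec_norm_1 (w q)) = I * v"
    using ge le1[of 1] le1[of 2] le2 n1 by linarith+
  obtain u1 where u1: "AE q in lebesgue. w q $ 1 = u1 * of_real (cmod (w q $ 1))"
    using integral_norm_eq_imp_constant_phase[OF wi eq1] .
  obtain u2 where u2: "AE q in lebesgue. w q $ 2 = u2 * of_real (cmod (w q $ 2))"
    using integral_norm_eq_imp_constant_phase[OF wi eq2] .
  have "v > 0"
  proof -
    have "v \<noteq> 0"
      using eq Kw eqI n1 eq1 eq2 by auto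
    with v_nonneg show ?thesis by simp
  qed
  let ?F = "\<lambda>q. mat_norm_1 (green k p q) * v - vec_norm_1 (green k p q *v (V q *s g q))"
  have F_int: "set_integrable lebesgue S ?F"
    by (intro set_integral_diff set_integrable_mult_left mat_norm_1_green_integrable
        scattered_norm_integrable p g)
  have "(LINT q:S|lebesgue. ?F q) = 0"
    using eqI by (simp add: n1_set I_def set_integral_diff set_integrable_mult_left
        mat_norm_1_green_integrable scattered_norm_integrable p g)
  moreover have "AE q in lebesgue. 0 \<le> indicator S q *\<^sub>R ?F q"
    using scattered_bound[where f = g and A = "green k p", OF g1] by eventually_elim (auto simp: indicator_def)
  ultimately have "AE q in lebesgue. indicator S q *\<^sub>R ?F q = 0"
    using F_int integral_nonneg_eq_0_iff_AE[of lebesgue "\<lambda>q. indicator S q *\<^sub>R ?F q"]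
    by (simp add: set_integrable_def set_lebesgue_integral_def)
  then have "AE q in lebesgue. q \<in> S \<longrightarrow>
      vec_norm_1 (green k p q *v (V q *s g q)) = mat_norm_1 (green k p q) * v"
    by eventually_elim (auto simp: indicator_def)
  moreover have "AE q in lebesgue. q \<in> S \<longrightarrow> (green k p q *v (V q *s g q)) $ 1
      = u1 * of_real (cmod ((green k p q *v (V q *s g q)) $ 1))"
    using u1 by eventually_elim (auto simp: w_def)
  moreover have "AE q in lebesgue. q \<in> S \<longrightarrow> (green k p q *v (V q *s g q)) $ 2
      = u2 * of_real (cmod ((green k p q *v (V q *s g q)) $ 2))"
    using u2 by eventually_elim (auto simp: w_def)
  ultimately show ?thesis
    using that \<open>v > 0\<close> by blast
qed

end

section \<open>Norm one is not attained twice in succession\<close>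

text \<open>The entries of \<open>G\<close> in terms of the displacement \<open>(x, y)\<close>: a reflection \<open>y \<mapsto> - y\<close> changes the sign of
  the off-diagonal entries, and \<open>x \<mapsto> - x\<close> exchanges the diagonal ones.\<close>

lemma green_entries_shift:
  fixes k :: real and q :: "real \<times> real"
  defines "a r \<equiv> \<i> * hankel1 0 (k * r)" and "b r \<equiv> hankel1 1 (k * r)"
  assumes d: "p - q = (x, y)"
  shows "green k p q $ 1 $ 1 = of_real (k / 4) * (a (norm (x, y)) + b (norm (x, y)) * of_real (x / norm (x, y)))"
    and "green k p q $ 1 $ 2 = of_real (k / 4) * (b (norm (x, y)) * of_real (y / norm (x, y)))"
    and "green k p q $ 2 $ 1 = of_real (k / 4) * (b (norm (x, y)) * of_real (y / norm (x, y)))"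
    and "green k p q $ 2 $ 2 = of_real (k / 4) * (a (norm (x, y)) - b (norm (x, y)) * of_real (x / norm (x, y)))"
proof -
  have "fst p - fst q = x" "snd p - snd q = y"
    using d by (simp_all add: prod_eq_iff)
  then show
    "green k p q $ 1 $ 1 = of_real (k / 4) * (a (norm (x, y)) + b (norm (x, y)) * of_real (x / norm (x, y)))"
    "green k p q $ 1 $ 2 = of_real (k / 4) * (b (norm (x, y)) * of_real (y / norm (x, y)))"
    "green k p q $ 2 $ 1 = of_real (k / 4) * (b (norm (x, y)) * of_real (y / norm (x, y)))"
    "green k p q $ 2 $ 2 = of_real (k / 4) * (a (norm (x, y)) - b (norm (x, y)) * of_real (x / norm (x, y)))"
    unfolding green_entries a_def b_def d by simp_all
qed

text \<open>If all entries vanish, then \<open>b s = 0\<close> and \<open>b c = 0\<close>, so \<open>b = 0\<close>.\<close>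

lemma mat_norm_1_green_pos:
  assumes "k > 0" "p \<noteq> q" "hankel1 1 (k * norm (p - q)) \<noteq> 0"
  shows "mat_norm_1 (green k p q) > 0"
proof (rule ccontr)
  obtain x y where d: "p - q = (x, y)" by fastforce
  note e = green_entries_shift[where k = k, OF d]
  let ?r = "norm (x, y)"
  have r: "?r > 0" using assms(2) d by (metis right_minus_eq zero_less_norm_iff)
  have b: "hankel1 1 (k * ?r) \<noteq> 0" using assms(3) d by simp
  assume "\<not> mat_norm_1 (green k p q) > 0"
  moreover have "cmod (green k p q $ 1 $ 1) \<ge> 0" "cmod (green k p q $ 2 $ 1) \<ge> 0"
    "cmod (green k p q $ 1 $ 2) \<ge> 0" "cmod (green k p q $ 2 $ 2) \<ge> 0" by simp_all
  ultimately have "cmod (green k p q $ 1 $ 1) = 0" "cmod (green k p q $ 2 $ 1) = 0" "cmod (green k p q $ 2 $ 2) = 0"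
    unfolding mat_norm_1_2 by linarith+
  then have z: "green k p q $ 1 $ 1 = 0" "green k p q $ 2 $ 1 = 0" "green k p q $ 2 $ 2 = 0" by simp_all
  have k4: "of_real (k / 4) \<noteq> (0::complex)" using assms(1) by simp
  have "hankel1 1 (k * ?r) * of_real (y / ?r) = 0"
    using z(2) k4 unfolding e by (metis mult_eq_0_iff)
  then have y: "y = 0" using b r by simp
  have "\<i> * hankel1 0 (k * ?r) + hankel1 1 (k * ?r) * of_real (x / ?r) = 0"
    "\<i> * hankel1 0 (k * ?r) - hankel1 1 (k * ?r) * of_real (x / ?r) = 0"
    using z(1,3) k4 unfolding e by (metis mult_eq_0_iff)+
  then have "2 * (hankel1 1 (k * ?r) * of_real (x / ?r)) = 0" by algebra
  then have "x = 0" using b r by simp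
  with y r show False by (simp add: norm_Pair)
qed

lemma opposite_phase_imp_zero:
  fixes x y x' y' u :: complex
  assumes "x * cnj y = u * of_real (cmod x * cmod y)"
    and "x' * cnj y' = u * of_real (cmod x' * cmod y')"
    and "x' * cnj y' = - (x * cnj y)" "cmod x' = cmod x" "cmod y' = cmod y"
  shows "x = 0 \<or> y = 0"
proof -
  have "x * cnj y = - (x * cnj y)"
    using assms by simp
  then show ?thesis by simp
qed

text \<open>The four diagonal displacements are permuted by reflections in the axes and have no vanishing
  component, as the reflection arguments require.\<close>

lemma corners_in_open:
  assumes "open U" "(q :: real \<times> real) \<in> U"
  obtains t where "t > 0" "\<And>x y. \<bar>x\<bar> = t \<Longrightarrow> \<bar>y\<bar> = t \<Longrightarrow> q + (x, y) \<in> U"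
proof -
  obtain e where e: "e > 0" "ball q e \<subseteq> U" using assms open_contains_ball by blast
  have "q + (x, y) \<in> U" if "\<bar>x\<bar> = e / 3" "\<bar>y\<bar> = e / 3" for x y
  proof -
    have "norm (x, y) \<le> norm x + norm y"
      by (simp add: norm_Pair sqrt_sum_squares_le_sum_abs)
    also have "\<dots> < e" using that e by simp
    finally have "q + (x, y) \<in> ball q e" by (simp add: dist_norm norm_Pair)
    then show ?thesis using e by blast
  qed
  then show ?thesis using e by (intro that[of "e / 3"]) auto
qed

context dirac_scattering
begin

text \<open>\<open>V\<close> is merely measurable, but its modulus is \<open>v > 0\<close> almost everywhere on \<open>U\<close> and its phase
  cancels from the relative phase of the two components. What remains are equations between
  continuous functions of \<open>q \<noteq> p\<close>, which therefore hold everywhere.\<close>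

lemma equality_pointwise:
  assumes p: "p \<in> S" and g: "g \<in> contS" and g1: "\<forall>q\<in>S. vec_norm_1 (g q) \<le> 1"
    and eq: "vec_norm_1 (K g p) = 1"
    and U: "open U" "U \<subseteq> S" and pos: "\<forall>q\<in>U - {p}. mat_norm_1 (green k p q) > 0"
  shows "\<exists>u. \<forall>q\<in>U - {p}. vec_norm_1 (g q) = 1 \<and>
    vec_norm_1 (green k p q *v g q) = mat_norm_1 (green k p q) \<and>
    (green k p q *v g q) $ 1 * cnj ((green k p q *v g q) $ 2)
       = u * of_real (cmod ((green k p q *v g q) $ 1) * cmod ((green k p q *v g q) $ 2))"
proof -
  define W where "W = U - {p}"
  define h where "h q = green k p q *v g q" for q
  have W: "open W" using U by (simp add: W_def open_delete)
  have "W \<subseteq> S" using U by (auto simp: W_def)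
  then have g_cont: "continuous_on W g"
    using g by (auto simp: contS_def intro: continuous_on_subset)
  have green_cont: "continuous_on W (green k p)"
    by (subst green_eq_translate, rule continuous_on_compose2[OF continuous_on_green[OF k_pos]])
      (auto simp: W_def intro!: continuous_intros)
  have h_cont: "continuous_on W h"
    unfolding h_def by (intro continuous_intros g_cont green_cont)
  have hV: "green k p q *v (V q *s g q) = V q *s h q" for q
    by (simp add: vec_eq_iff matrix_vector_mult_2 h_def algebra_simps)
  obtain u1 u2 where v: "v > 0"
    and ae: "AE q in lebesgue. q \<in> S \<longrightarrow> vec_norm_1 (V q *s h q) = mat_norm_1 (green k p q) * v"
    "AE q in lebesgue. q \<in> S \<longrightarrow> (V q *s h q) $ 1 = u1 * of_real (cmod ((V q *s h q) $ 1))"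
    "AE q in lebesgue. q \<in> S \<longrightarrow> (V q *s h q) $ 2 = u2 * of_real (cmod ((V q *s h q) $ 2))"
    using K_equality[OF p g g1 eq] unfolding hV by blast
  define u where "u = u1 * cnj u2"
  have tight: "AE q in lebesgue. q \<in> W \<longrightarrow> cmod (V q) = v \<and> vec_norm_1 (g q) = 1 \<and>
      vec_norm_1 (h q) = mat_norm_1 (green k p q)"
    using ae(1) V_bound
  proof eventually_elim
    case (elim q)
    show ?case
    proof
      assume qW: "q \<in> W"
      with \<open>W \<subseteq> S\<close> have q: "q \<in> S" by blast
      let ?N = "mat_norm_1 (green k p q)"
      have N: "?N > 0" using pos qW by (simp add: W_def)
      have Vq: "cmod (V q) \<le> v" using elim(2) q by blast
      have E: "cmod (V q) * vec_norm_1 (h q) = ?N * v" using elim(1) q by simp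
      have "vec_norm_1 (h q) \<le> ?N * vec_norm_1 (g q)"
        unfolding h_def by (rule vec_norm_1_mult_le)
      then have "?N * v \<le> cmod (V q) * (?N * vec_norm_1 (g q))"
        unfolding E[symmetric] by (rule mult_left_mono) simp
      then have "?N * v \<le> ?N * (cmod (V q) * vec_norm_1 (g q))" by (simp add: mult_ac)
      then have *: "v \<le> cmod (V q) * vec_norm_1 (g q)" using N by simp
      have "cmod (V q) * vec_norm_1 (g q) \<le> cmod (V q) * 1"
        using g1 q by (intro mult_left_mono) auto
      with * Vq have V: "cmod (V q) = v" by simp
      have "vec_norm_1 (g q) \<ge> 1" using * V v by simp
      moreover have "vec_norm_1 (g q) \<le> 1" using g1 q by blast
      moreover have "vec_norm_1 (h q) = ?N" using E V v by simp
      ultimately show "cmod (V q) = v \<and> vec_norm_1 (g q) = 1 \<and> vec_norm_1 (h q) = ?N"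
        using V by simp
    qed
  qed
  have "AE q in lebesgue. q \<in> W \<longrightarrow> vec_norm_1 (g q) - 1 = 0"
    using tight by eventually_elim auto
  then have c1: "vec_norm_1 (g q) - 1 = 0" if "q \<in> W" for q
    by (rule AE_imp_everywhere_on_open[OF W _ _ that, rotated]) (intro continuous_intros g_cont)
  have "AE q in lebesgue. q \<in> W \<longrightarrow> vec_norm_1 (h q) - mat_norm_1 (green k p q) = 0"
    using tight by eventually_elim auto
  then have c2: "vec_norm_1 (h q) - mat_norm_1 (green k p q) = 0" if "q \<in> W" for q
    by (rule AE_imp_everywhere_on_open[OF W _ _ that, rotated]) (intro continuous_intros h_cont green_cont)
  have "AE q in lebesgue. q \<in> W \<longrightarrow> h q $ 1 * cnj (h q $ 2) - u * of_real (cmod (h q $ 1) * cmod (h q $ 2)) = 0"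
    using tight ae(2,3)
  proof eventually_elim
    case (elim q)
    show ?case
    proof
      assume qW: "q \<in> W"
      with \<open>W \<subseteq> S\<close> have q: "q \<in> S" by blast
      have Vq: "V q \<noteq> 0" using elim(1) qW v by auto
      have "V q * h q $ 1 = u1 * of_real (cmod (V q) * cmod (h q $ 1))"
        "V q * h q $ 2 = u2 * of_real (cmod (V q) * cmod (h q $ 2))"
        using elim(2,3) q by (simp_all add: norm_mult)
      then have "(V q * h q $ 1) * cnj (V q * h q $ 2) =
          (u1 * of_real (cmod (V q) * cmod (h q $ 1))) * cnj (u2 * of_real (cmod (V q) * cmod (h q $ 2)))"
        by (simp only:)
      then have "(V q * cnj (V q)) * (h q $ 1 * cnj (h q $ 2)) =
          (of_real (cmod (V q)) * of_real (cmod (V q))) * (u * of_real (cmod (h q $ 1) * cmod (h q $ 2)))"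
        by (simp add: u_def mult_ac)
      moreover have "of_real (cmod (V q)) * of_real (cmod (V q)) = V q * cnj (V q)"
        by (simp add: complex_norm_square[symmetric] power2_eq_square)
      ultimately show "h q $ 1 * cnj (h q $ 2) - u * of_real (cmod (h q $ 1) * cmod (h q $ 2)) = 0"
        using Vq by simp
    qed
  qed
  then have c3: "h q $ 1 * cnj (h q $ 2) - u * of_real (cmod (h q $ 1) * cmod (h q $ 2)) = 0" if "q \<in> W" for q
    by (rule AE_imp_everywhere_on_open[OF W _ _ that, rotated]) (intro continuous_intros h_cont)
  show ?thesis
    by (intro exI[of _ u] ballI) (use c1 c2 c3 in \<open>simp add: W_def h_def\<close>)
qed

text \<open>The two reflection arguments: first one component of \<open>g\<close> vanishes at each point of \<open>U\<close>, and then
  the relative phase, on a neighbourhood \<open>W\<close> where it is always the same component, leads to a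
  contradiction.\<close>

lemma norm_not_attained_on_open:
  assumes g: "g \<in> contS" and g1: "\<forall>q\<in>S. vec_norm_1 (g q) \<le> 1"
    and U: "open U" "U \<subseteq> S" "U \<noteq> {}"
    and eq: "\<And>p. p \<in> U \<Longrightarrow> vec_norm_1 (K g p) = 1"
    and H: "\<And>p q. p \<in> U \<Longrightarrow> q \<in> U \<Longrightarrow> p \<noteq> q \<Longrightarrow> hankel1 1 (k * norm (p - q)) \<noteq> 0"
  shows False
proof -
  have rigid: "\<exists>u. \<forall>q\<in>U - {p}. vec_norm_1 (g q) = 1 \<and>
      vec_norm_1 (green k p q *v g q) = mat_norm_1 (green k p q) \<and>
      (green k p q *v g q) $ 1 * cnj ((green k p q *v g q) $ 2)
        = u * of_real (cmod ((green k p q *v g q) $ 1) * cmod ((green k p q *v g q) $ 2))"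
    if p: "p \<in> U" for p
  proof (rule equality_pointwise[OF _ g g1 eq[OF p] U(1,2)])
    show "p \<in> S" using p U by blast
    show "\<forall>q\<in>U - {p}. mat_norm_1 (green k p q) > 0"
      using H[OF p] by (auto intro: mat_norm_1_green_pos[OF k_pos])
  qed
  have pointwise: "vec_norm_1 (g q) = 1"
      "vec_norm_1 (green k p q *v g q) = mat_norm_1 (green k p q)"
    if "p \<in> U" "q \<in> U" "q \<noteq> p" for p q
    using rigid[OF that(1)] that(2,3) by auto
  have k4: "of_real (k / 4) \<noteq> (0::complex)" using k_pos by simp
  \<comment> \<open>here \<open>q\<close> is fixed and \<open>p\<close> is placed at \<open>q + (t, t)\<close> and at its mirror image\<close>
  have one_zero: "g q $ 1 = 0 \<or> g q $ 2 = 0" if q: "q \<in> U" for q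
  proof (rule ccontr)
    assume nz: "\<not> (g q $ 1 = 0 \<or> g q $ 2 = 0)"
    obtain t where t: "t > 0" "\<And>x y. \<bar>x\<bar> = t \<Longrightarrow> \<bar>y\<bar> = t \<Longrightarrow> q + (x, y) \<in> U"
      using corners_in_open[OF U(1) q] by blast
    define r where "r = norm (t, t)"
    have r: "r > 0" "norm (t, - t) = r" using t by (auto simp: r_def norm_Pair)
    let ?p = "q + (t, t)" and ?p' = "q + (t, - t)"
    have pU: "?p \<in> U" "?p' \<in> U" using t by auto
    have ne: "q \<noteq> ?p" "q \<noteq> ?p'" using t by (auto simp: prod_eq_iff)
    have b: "hankel1 1 (k * r) \<noteq> 0"
      using H[OF pU(1) q] ne by (auto simp: r_def)
    have d: "?p - q = (t, t)" "?p' - q = (t, - t)" by simp_all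
    note e = green_entries_shift[where k = k, OF d(1), folded r_def]
      and e' = green_entries_shift[where k = k, OF d(2), unfolded r(2)]
    have off: "of_real (k / 4) * (hankel1 1 (k * r) * of_real (t / r)) \<noteq> 0"
      using k4 b t r by simp
    have attained: "vec_norm_1 (green k p q *v g q) = mat_norm_1 (green k p q) * vec_norm_1 (g q)"
      if "p \<in> U" "q \<noteq> p" for p
      using pointwise[OF that(1) q that(2)] by simp
    have "green k ?p q $ 1 $ 1 = 0" "green k ?p q $ 2 $ 2 = 0"
      by (rule diagonal_zero_if_norm_attained[OF attained[OF pU(1) ne(1)] attained[OF pU(2) ne(2)]];
          use off nz in \<open>simp add: e e'\<close>)+
    then have "\<i> * hankel1 0 (k * r) + hankel1 1 (k * r) * of_real (t / r) = 0"
      "\<i> * hankel1 0 (k * r) - hankel1 1 (k * r) * of_real (t / r) = 0"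
      using k4 unfolding e by (metis mult_eq_0_iff)+
    then have "2 * (hankel1 1 (k * r) * of_real (t / r)) = 0" by algebra
    then show False using off by simp
  qed
  obtain p where p: "p \<in> U" using U by blast
  obtain s where s: "s > 0" "\<And>x y. \<bar>x\<bar> = s \<Longrightarrow> \<bar>y\<bar> = s \<Longrightarrow> p + (x, y) \<in> U"
    using corners_in_open[OF U(1) p] by blast
  have "vec_norm_1 (g p) = 1"
    using pointwise(1)[of "p + (s, s)" p] s p by (auto simp: prod_eq_iff)
  then obtain j where j: "g p $ j \<noteq> 0"
    unfolding vec_norm_1_def by force
  define W where "W = {q \<in> U. g q $ j \<noteq> 0}"
  have "open W"
  proof -
    have "continuous_on U (\<lambda>q. g q $ j)"
      using g U by (auto simp: contS_def intro!: continuous_intros intro: continuous_on_subset)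
    moreover have "W = U \<inter> (\<lambda>q. g q $ j) -` (- {0})" by (auto simp: W_def)
    ultimately show ?thesis
      using continuous_open_preimage[of U "\<lambda>q. g q $ j" "- {0}"] U(1) by auto
  qed
  moreover have "p \<in> W" using p j by (simp add: W_def)
  ultimately obtain t where t: "t > 0" "\<And>x y. \<bar>x\<bar> = t \<Longrightarrow> \<bar>y\<bar> = t \<Longrightarrow> p + (x, y) \<in> W"
    using corners_in_open by blast
  obtain u where u: "\<And>q. q \<in> U \<Longrightarrow> q \<noteq> p \<Longrightarrow> (green k p q *v g q) $ 1 * cnj ((green k p q *v g q) $ 2)
       = u * of_real (cmod ((green k p q *v g q) $ 1) * cmod ((green k p q *v g q) $ 2))"
    using rigid[OF p] by auto
  \<comment> \<open>now \<open>p\<close> is fixed; the sign is such that \<open>p - q x y = (x, y)\<close>\<close>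
  define q where "q x y = p + (- x, - y)" for x y :: real
  define r where "r = norm (t, t)"
  have r: "r > 0" "norm (x, y) = r" if "\<bar>x\<bar> = t" "\<bar>y\<bar> = t" for x y
    using t(1) that power2_abs[of x] power2_abs[of y] by (auto simp: r_def norm_Pair)
  have qW: "q x y \<in> W" if "\<bar>x\<bar> = t" "\<bar>y\<bar> = t" for x y
    using t(2)[of "- x" "- y"] that by (simp add: q_def)
  have b: "hankel1 1 (k * r) \<noteq> 0"
  proof -
    have "q t t \<in> U" using qW[of t t] t(1) by (simp add: W_def)
    moreover have "p - q t t = (t, t)" by (simp add: q_def)
    moreover have "p \<noteq> q t t" using t(1) by (auto simp: q_def prod_eq_iff)
    ultimately show ?thesis
      using H[of p "q t t"] p by (simp add: r_def)
  qed
  have entries: "green k p (q x y) $ 1 $ 1 = of_real (k / 4) * (\<i> * hankel1 0 (k * r) + hankel1 1 (k * r) * of_real (x / r))"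
    "green k p (q x y) $ 1 $ 2 = of_real (k / 4) * (hankel1 1 (k * r) * of_real (y / r))"
    "green k p (q x y) $ 2 $ 1 = of_real (k / 4) * (hankel1 1 (k * r) * of_real (y / r))"
    "green k p (q x y) $ 2 $ 2 = of_real (k / 4) * (\<i> * hankel1 0 (k * r) - hankel1 1 (k * r) * of_real (x / r))"
    if "\<bar>x\<bar> = t" "\<bar>y\<bar> = t" for x y
    using green_entries_shift[where k = k and p = p and q = "q x y" and x = x and y = y] r(2)[OF that]
    by (simp_all add: q_def)
  have phase: "green k p (q x y) $ 1 $ j * cnj (green k p (q x y) $ 2 $ j)
      = u * of_real (cmod (green k p (q x y) $ 1 $ j) * cmod (green k p (q x y) $ 2 $ j))"
    if xy: "\<bar>x\<bar> = t" "\<bar>y\<bar> = t" for x y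
  proof -
    let ?q = "q x y" and ?A = "green k p (q x y)"
    have qU: "?q \<in> U" and gj: "g ?q $ j \<noteq> 0"
      using qW[OF xy] by (auto simp: W_def)
    have "?q \<noteq> p" using xy t(1) by (auto simp: q_def prod_eq_iff)
    have j12: "j = 1 \<or> j = 2" using exhaust_2 by auto
    \<comment> \<open>only column \<open>j\<close> of the matrix contributes\<close>
    have "(?A *v g ?q) $ i = ?A $ i $ j * g ?q $ j" for i
      using one_zero[OF qU] gj j12 by (auto simp: matrix_vector_mult_2)
    with u[OF qU \<open>?q \<noteq> p\<close>] have
      "(?A $ 1 $ j * g ?q $ j) * cnj (?A $ 2 $ j * g ?q $ j)
        = u * of_real (cmod (?A $ 1 $ j * g ?q $ j) * cmod (?A $ 2 $ j * g ?q $ j))"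
      by simp
    then have "(g ?q $ j * cnj (g ?q $ j)) * (?A $ 1 $ j * cnj (?A $ 2 $ j)) =
        (of_real (cmod (g ?q $ j)) * of_real (cmod (g ?q $ j))) * (u * of_real (cmod (?A $ 1 $ j) * cmod (?A $ 2 $ j)))"
      by (simp add: norm_mult mult_ac)
    moreover have "of_real (cmod (g ?q $ j)) * of_real (cmod (g ?q $ j)) = g ?q $ j * cnj (g ?q $ j)"
      by (simp add: complex_norm_square[symmetric] power2_eq_square)
    ultimately show ?thesis using gj by simp
  qed
  have off: "of_real (k / 4) * (hankel1 1 (k * r) * of_real (t / r)) \<noteq> 0"
    using k4 b t(1) r(1)[of t t] by simp
  have tt: "\<bar>t\<bar> = t" "\<bar>- t\<bar> = t" using t(1) by simp_all
  have diag: "green k p (q x t) $ j $ j = 0" if x: "\<bar>x\<bar> = t" for x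
  proof -
    have "j = 1 \<or> j = 2" using exhaust_2 by auto
    moreover have "green k p (q x t) $ 1 $ j = 0 \<or> green k p (q x t) $ 2 $ j = 0"
      by (rule opposite_phase_imp_zero[OF phase[OF x tt(1)] phase[OF x tt(2)]])
        (use \<open>j = 1 \<or> j = 2\<close> in \<open>auto simp: entries[OF x tt(1)] entries[OF x tt(2)] norm_mult\<close>)
    ultimately show ?thesis
      using off by (auto simp: entries[OF x tt(1)])
  qed
  have "\<i> * hankel1 0 (k * r) + hankel1 1 (k * r) * of_real (t / r) = 0 \<and>
      \<i> * hankel1 0 (k * r) - hankel1 1 (k * r) * of_real (t / r) = 0"
  proof -
    have "j = 1 \<or> j = 2" using exhaust_2 by auto
    then show ?thesis
      using diag[OF tt(1)] diag[OF tt(2)] k4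
      by (auto simp: entries[OF tt(1) tt(1)] entries[OF tt(2) tt(1)])
  qed
  then have "2 * (hankel1 1 (k * r) * of_real (t / r)) = 0" by algebra
  then show False using off by simp
qed

text \<open>Two applications of \<open>K\<close> are needed because \<open>norm_not_attained_on_open\<close> wants norm 1 on an open set: the
  equality case for \<open>K g\<close> at the single point \<open>p\<close> says that \<open>K g\<close> has norm 1 near \<open>p\<close>.\<close>

lemma norm_K_K_not_attained:
  assumes g: "g \<in> contS" and g1: "\<forall>q\<in>S. vec_norm_1 (g q) \<le> 1" and p: "p \<in> S"
  shows "vec_norm_1 (K (K g) p) \<noteq> 1"
proof
  assume eq: "vec_norm_1 (K (K g) p) = 1"
  obtain r where r: "r > 0" "\<And>z. 0 < z \<Longrightarrow> z < r \<Longrightarrow> hankel1 1 z \<noteq> 0"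
    using hankel1_1_nonzero_near_0 by blast
  have H: "hankel1 1 (k * norm (p - q)) \<noteq> 0" if "p \<noteq> q" "norm (p - q) < r / k" for p q :: "real \<times> real"
    using r(2)[of "k * norm (p - q)"] k_pos that by (simp add: field_simps)
  define U where "U = ball p (r / k) \<inter> interior S"
  have U: "open U" "U \<subseteq> S" using interior_subset by (auto simp: U_def)
  have "r / k > 0" using r k_pos by simp
  then have "U \<noteq> {}"
    using S_regular p by (force simp: U_def closure_approachable dist_commute)
  have Kg1: "\<forall>q\<in>S. vec_norm_1 (K g q) \<le> 1"
    using K_bound[OF _ g g1] by blast
  have "\<forall>q\<in>U - {p}. mat_norm_1 (green k p q) > 0"
    by (intro ballI mat_norm_1_green_pos k_pos H) (auto simp: U_def dist_norm)
  from equality_pointwise[OF p K_cont[OF g] Kg1 eq U this]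
  have attained: "vec_norm_1 (K g q) = 1" if "q \<in> U - {p}" for q
    using that by blast
  have "open (U - {p})" using U by (simp add: open_delete)
  moreover have "U - {p} \<noteq> {}"
    using \<open>U \<noteq> {}\<close> U(1) not_open_singleton[of p] by (metis Diff_eq_empty_iff subset_singleton_iff)
  ultimately obtain q e where q: "e > 0" "ball q e \<subseteq> U - {p}"
    by (meson ex_in_conv open_contains_ball)
  \<comment> \<open>the radius keeps \<open>k * norm (p\<^sub>1 - p\<^sub>2)\<close> in the zero-free interval \<open>(0, r)\<close> of \<open>H\<^sub>1\<close> for all distinct \<open>p\<^sub>1\<close>, \<open>p\<^sub>2\<close> in the ball\<close>
  define B where "B = ball q (min e (r / (2 * k)))"
  have "B \<subseteq> U - {p}" using q(2) by (auto simp: B_def)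
  have "q \<in> B" using q(1) r(1) k_pos by (simp add: B_def)
  show False
  proof (rule norm_not_attained_on_open[OF g g1, of B])
    show "open B" "B \<subseteq> S" "B \<noteq> {}"
      using \<open>q \<in> B\<close> \<open>B \<subseteq> U - {p}\<close> U by (auto simp: B_def)
    show "vec_norm_1 (K g p') = 1" if "p' \<in> B" for p'
      using that q(2) by (intro attained) (auto simp: B_def)
    show "hankel1 1 (k * norm (p' - q')) \<noteq> 0" if "p' \<in> B" "q' \<in> B" "p' \<noteq> q'" for p' q'
    proof (rule H[OF that(3)])
      have "dist p' q' \<le> dist q p' + dist q q'" by (rule dist_triangle3)
      also have "\<dots> < r / (2 * k) + r / (2 * k)"
        using that by (intro add_strict_mono) (auto simp: B_def)
      also have "\<dots> = r / k" using k_pos by (simp add: field_simps)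
      finally show "norm (p' - q') < r / k" by (simp add: dist_norm)
    qed
  qed
qed

section \<open>The third power of the operator is a contraction\<close>

text \<open>The innermost application of \<open>K\<close> provides compactness: the almost extremal \<open>F n\<close> need not converge,
  but \<open>K (F n)\<close> has a convergent subsequence, and its limit \<open>g\<close> satisfies \<open>\<parallel>K (K g)\<parallel> = 1\<close>.\<close>

lemma K_K_K_strict:
  obtains c where "0 \<le> c" "c < 1"
    "\<And>f p. f \<in> contS \<Longrightarrow> \<forall>q\<in>S. vec_norm_1 (f q) \<le> 1 \<Longrightarrow> p \<in> S \<Longrightarrow> vec_norm_1 (K (K (K f)) p) \<le> c"
proof (rule ccontr)
  assume "\<not> thesis"
  have "\<exists>f p. f \<in> contS \<and> (\<forall>q\<in>S. vec_norm_1 (f q) \<le> 1) \<and> p \<in> S \<and>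
      vec_norm_1 (K (K (K f)) p) > 1 - inverse (real (Suc n))" for n
  proof (rule ccontr)
    assume "\<not> ?thesis"
    then show False
      using \<open>\<not> thesis\<close> that[of "1 - inverse (real (Suc n))"] by (force simp: inverse_le_1_iff not_less)
  qed
  then obtain F P where F: "\<And>n. F n \<in> contS" "\<And>n. \<forall>q\<in>S. vec_norm_1 (F n q) \<le> 1"
    and P: "\<And>n::nat. P n \<in> S" "\<And>n. vec_norm_1 (K (K (K (F n))) (P n)) > 1 - inverse (real (Suc n))"
    by metis
  have KF: "vec_norm_1 (K (F n) q) \<le> 1" if "q \<in> S" for n q
    by (rule K_bound[OF that F])
  obtain g \<kappa> where g: "continuous_on S g" and \<kappa>: "strict_mono (\<kappa> :: nat \<Rightarrow> nat)"
    and lim: "\<And>e. 0 < e \<Longrightarrow> \<exists>N. \<forall>n x. n \<ge> N \<and> x \<in> S \<longrightarrow> norm (K (F (\<kappa> n)) x - g x) < e"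
  proof (rule Arzela_Ascoli[OF S_compact, of "\<lambda>n. K (F n)" 1])
    show "norm (K (F n) x) \<le> 1" if "x \<in> S" for n x
      using norm_le_vec_norm_1[of "K (F n) x"] KF[OF that, of n] by linarith
    show "\<exists>d>0. \<forall>n y. y \<in> S \<and> norm (x - y) < d \<longrightarrow> norm (K (F n) x - K (F n) y) < e"
      if "x \<in> S" "0 < e" for x e
    proof -
      obtain d where "d > 0" "\<And>f p p'. f \<in> contS \<Longrightarrow> (\<forall>q\<in>S. vec_norm_1 (f q) \<le> 1) \<Longrightarrow> p \<in> S \<Longrightarrow> p' \<in> S \<Longrightarrow>
          norm (p - p') < d \<Longrightarrow> norm (K f p - K f p') < e"
        by (rule K_equicontinuous[OF \<open>0 < e\<close>, of 1]) blast
      then show ?thesis using F \<open>x \<in> S\<close> by blast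
    qed
  qed blast
  have gS: "g \<in> contS" using g by (simp add: contS_def)
  have close: "\<exists>N. \<forall>n\<ge>N. \<forall>x\<in>S. vec_norm_1 (K (F (\<kappa> n)) x - g x) \<le> e" if "e > 0" for e
  proof -
    obtain N where N: "\<And>n x. n \<ge> N \<Longrightarrow> x \<in> S \<Longrightarrow> norm (K (F (\<kappa> n)) x - g x) < e / 2"
      using lim[of "e / 2"] \<open>e > 0\<close> by auto
    have "vec_norm_1 (K (F (\<kappa> n)) x - g x) \<le> e" if "n \<ge> N" "x \<in> S" for n x
      using N[OF that] vec_norm_1_le_norm[of "K (F (\<kappa> n)) x - g x"] by linarith
    then show ?thesis by blast
  qed
  have g1: "\<forall>q\<in>S. vec_norm_1 (g q) \<le> 1"
  proof (rule ballI, rule field_le_epsilon)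
    fix q and e :: real assume q: "q \<in> S" and "e > 0"
    obtain N where "vec_norm_1 (K (F (\<kappa> N)) q - g q) \<le> e"
      using close[OF \<open>e > 0\<close>] q by blast
    then have "vec_norm_1 (g q - K (F (\<kappa> N)) q) \<le> e"
      using vec_norm_1_scaleR[of "- 1" "K (F (\<kappa> N)) q - g q"] by simp
    then show "vec_norm_1 (g q) \<le> 1 + e"
      using vec_norm_1_add[of "K (F (\<kappa> N)) q" "g q - K (F (\<kappa> N)) q"] KF[OF q, of "\<kappa> N"] by simp
  qed
  obtain p where p: "p \<in> S" "\<forall>q\<in>S. vec_norm_1 (K (K g) q) \<le> vec_norm_1 (K (K g) p)"
    using attains_max[OF K_cont[OF K_cont[OF gS]]] by blast
  have Kg1: "\<forall>q\<in>S. vec_norm_1 (K g q) \<le> 1"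
    using K_bound[OF _ gS g1] by blast
  have "vec_norm_1 (K (K g) p) \<le> 1"
    by (rule K_bound[OF p(1) K_cont[OF gS] Kg1])
  moreover have "1 \<le> vec_norm_1 (K (K g) p)"
  proof (rule field_le_epsilon)
    fix e :: real assume "e > 0"
    obtain N where N: "\<forall>n\<ge>N. \<forall>x\<in>S. vec_norm_1 (K (F (\<kappa> n)) x - g x) \<le> e / 2"
      using close[of "e / 2"] \<open>e > 0\<close> by auto
    obtain m where m: "inverse (real (Suc m)) < e / 2"
      using reals_Archimedean[of "e / 2"] \<open>e > 0\<close> by auto
    define n where "n = max N m"
    let ?f = "F (\<kappa> n)" and ?x = "P (\<kappa> n)"
    have "m \<le> \<kappa> n" using seq_suble[OF \<kappa>, of n] by (simp add: n_def)
    then have "inverse (real (Suc (\<kappa> n))) \<le> inverse (real (Suc m))"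
      by (intro le_imp_inverse_le) auto
    with m have big: "vec_norm_1 (K (K (K ?f)) ?x) > 1 - e / 2"
      using P(2)[of "\<kappa> n"] by linarith
    let ?d = "\<lambda>x. K ?f x - g x"
    have cont: "?d \<in> contS" "K ?f \<in> contS" "K ?d \<in> contS"
      using F gS by (auto intro!: contS_diff K_cont)
    have "\<forall>q\<in>S. vec_norm_1 (?d q) \<le> e / 2" using N by (simp add: n_def)
    then have "\<forall>q\<in>S. vec_norm_1 (K ?d q) \<le> e / 2"
      using K_bound[OF _ cont(1)] by blast
    then have small: "vec_norm_1 (K (K ?d) ?x) \<le> e / 2"
      by (rule K_bound[OF P(1) cont(3)])
    have "K (K ?d) ?x = K (\<lambda>q. K (K ?f) q - K g q) ?x"
      by (rule K_cong) (rule K_diff[OF _ cont(2) gS])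
    also have "\<dots> = K (K (K ?f)) ?x - K (K g) ?x"
      using P(1) F(1) gS by (intro K_diff K_cont)
    finally have "K (K (K ?f)) ?x = K (K g) ?x + K (K ?d) ?x" by simp
    then have "vec_norm_1 (K (K (K ?f)) ?x) \<le> vec_norm_1 (K (K g) ?x) + vec_norm_1 (K (K ?d) ?x)"
      using vec_norm_1_add[of "K (K g) ?x"] by simp
    then show "1 \<le> vec_norm_1 (K (K g) p) + e"
      using big small p(2) P(1)[of "\<kappa> n"] by fastforce
  qed
  ultimately show False
    using norm_K_K_not_attained[OF gS g1 p(1)] by simp
qed

lemma K_K_K_contraction:
  obtains c where "0 \<le> c" "c < 1"
    "\<And>f p M. f \<in> contS \<Longrightarrow> \<forall>q\<in>S. vec_norm_1 (f q) \<le> M \<Longrightarrow> p \<in> S \<Longrightarrow> vec_norm_1 (K (K (K f)) p) \<le> c * M"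
proof -
  obtain c where c: "0 \<le> c" "c < 1"
    "\<And>f p. f \<in> contS \<Longrightarrow> \<forall>q\<in>S. vec_norm_1 (f q) \<le> 1 \<Longrightarrow> p \<in> S \<Longrightarrow> vec_norm_1 (K (K (K f)) p) \<le> c"
    using K_K_K_strict by blast
  have "vec_norm_1 (K (K (K f)) p) \<le> c * M"
    if f: "f \<in> contS" and M: "\<forall>q\<in>S. vec_norm_1 (f q) \<le> M" and p: "p \<in> S" for f p M
  proof (cases "M = 0")
    case True
    have "\<forall>q\<in>S. vec_norm_1 (K f q) \<le> 0" using K_bound[OF _ f] M True by blast
    then have "\<forall>q\<in>S. vec_norm_1 (K (K f) q) \<le> 0" using K_bound[OF _ K_cont[OF f]] by blast
    then have "vec_norm_1 (K (K (K f)) p) \<le> 0" by (rule K_bound[OF p K_cont[OF K_cont[OF f]]])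
    with True show ?thesis by simp
  next
    case False
    have "M \<ge> 0" using M p vec_norm_1_nonneg[of "f p"] by (meson order_trans)
    with False have Mpos: "M > 0" by simp
    have "\<forall>q\<in>S. vec_norm_1 ((1 / M) *\<^sub>R f q) \<le> 1"
      using M Mpos by simp
    from c(3)[OF contS_scaleR[OF f] this p]
    have "vec_norm_1 (K (K (K (\<lambda>q. (1 / M) *\<^sub>R f q))) p) \<le> c" .
    also have "K (\<lambda>q. (1 / M) *\<^sub>R f q) = (\<lambda>q. (1 / M) *\<^sub>R K f q)" by (rule ext) (rule K_scaleR)
    also have "K \<dots> = (\<lambda>q. (1 / M) *\<^sub>R K (K f) q)" by (rule ext) (rule K_scaleR)
    also have "K \<dots> p = (1 / M) *\<^sub>R K (K (K f)) p" by (rule K_scaleR)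
    finally show ?thesis using Mpos by (simp add: field_simps)
  qed
  with c(1,2) show ?thesis by (rule that)
qed

section \<open>Existence and uniqueness of the scattered field\<close>

lemma K_fixed_point_zero:
  assumes d: "d \<in> contS" and fixed: "\<forall>p\<in>S. d p = K d p" and p: "p \<in> S"
  shows "d p = 0"
proof -
  obtain c where c: "0 \<le> c" "c < 1"
    "\<And>f p M. f \<in> contS \<Longrightarrow> \<forall>q\<in>S. vec_norm_1 (f q) \<le> M \<Longrightarrow> p \<in> S \<Longrightarrow> vec_norm_1 (K (K (K f)) p) \<le> c * M"
    using K_K_K_contraction by blast
  obtain x where x: "x \<in> S" "\<forall>q\<in>S. vec_norm_1 (d q) \<le> vec_norm_1 (d x)"
    using attains_max[OF d] by blast
  have "K (K d) q = d q" if "q \<in> S" for q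
    using K_cong[of "K d" d q] fixed that by simp
  then have "K (K (K d)) x = d x"
    using K_cong[of "K (K d)" d x] fixed x by simp
  with c(3)[OF d x(2,1)] have "(1 - c) * vec_norm_1 (d x) \<le> 0" by (simp add: algebra_simps)
  then have "vec_norm_1 (d x) \<le> 0" using c(2) by (simp add: mult_le_0_iff)
  then have "vec_norm_1 (d p) = 0"
    using x(2) p vec_norm_1_nonneg[of "d p"] by (meson antisym order_trans)
  then show ?thesis by simp
qed

text \<open>If three steps gain the factor \<open>c\<close>, each step gains \<open>\<theta>\<close> with \<open>\<theta>\<^sup>3 \<ge> c\<close>, up to a constant that
  accounts for the first three iterates.\<close>

lemma K_iterates_geometric:
  assumes f: "f \<in> contS"
  obtains B \<theta> where "0 < \<theta>" "\<theta> < 1" "\<And>n p. p \<in> S \<Longrightarrow> vec_norm_1 ((K ^^ n) f p) \<le> B * \<theta> ^ n"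
proof -
  obtain c where c: "0 \<le> c" "c < 1"
    "\<And>f p M. f \<in> contS \<Longrightarrow> \<forall>q\<in>S. vec_norm_1 (f q) \<le> M \<Longrightarrow> p \<in> S \<Longrightarrow> vec_norm_1 (K (K (K f)) p) \<le> c * M"
    using K_K_K_contraction by blast
  \<comment> \<open>as \<open>\<theta> = 1 - (1 - c) / 3\<close>, Bernoulli's inequality gives \<open>\<theta>\<^sup>3 \<ge> c\<close>\<close>
  define \<theta> where "\<theta> = (2 + c) / 3"
  have \<theta>: "0 < \<theta>" "\<theta> < 1" using c by (auto simp: \<theta>_def)
  have "c \<le> \<theta> ^ 3"
  proof -
    have "\<theta> ^ 3 - c = (1 - c)\<^sup>2 * (8 + c) / 27"
      by (simp add: \<theta>_def power2_eq_square power3_eq_cube field_simps)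
    also have "\<dots> \<ge> 0" using c by simp
    finally show ?thesis by simp
  qed
  have cont: "(K ^^ n) f \<in> contS" for n by (induction n) (auto intro: f K_cont)
  obtain M where M: "M \<ge> 0" "\<forall>q\<in>S. vec_norm_1 (f q) \<le> M"
    using bounded_if_cont[OF f] by blast
  have M': "\<forall>p\<in>S. vec_norm_1 ((K ^^ n) f p) \<le> M" for n
  proof (induction n)
    case (Suc n)
    then show ?case using K_bound[OF _ cont] by simp
  qed (use M in simp)
  define B where "B = M / \<theta>\<^sup>2"
  have B: "B \<ge> 0" using M by (simp add: B_def)
  have "\<forall>p\<in>S. vec_norm_1 ((K ^^ n) f p) \<le> B * \<theta> ^ n" for n
  proof (induction n rule: less_induct)
    case (less n)
    show ?case
    proof (cases "n < 3")
      case True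
      then have "\<theta>\<^sup>2 \<le> \<theta> ^ n" using \<theta> by (intro power_decreasing) auto
      then have "B * \<theta>\<^sup>2 \<le> B * \<theta> ^ n" using B by (rule mult_left_mono)
      moreover have "B * \<theta>\<^sup>2 = M" using \<theta> by (simp add: B_def)
      ultimately show ?thesis using M'[of n] by fastforce
    next
      case False
      define m where "m = n - 3"
      have n: "n = Suc (Suc (Suc m))" using False by (simp add: m_def)
      have IH: "\<forall>p\<in>S. vec_norm_1 ((K ^^ m) f p) \<le> B * \<theta> ^ m"
        using less.IH[of m] n by simp
      have "c * (B * \<theta> ^ m) \<le> \<theta> ^ 3 * (B * \<theta> ^ m)"
        using \<open>c \<le> \<theta> ^ 3\<close> B \<theta> by (intro mult_right_mono) auto
      also have "\<dots> = B * \<theta> ^ n" by (simp add: n power3_eq_cube mult_ac)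
      finally have "c * (B * \<theta> ^ m) \<le> B * \<theta> ^ n" .
      then show ?thesis
        using c(3)[OF cont[of m] IH] by (fastforce simp: n)
    qed
  qed
  then show ?thesis using that[OF \<theta>] by blast
qed

lemma K_sum_iterates:
  assumes f: "f \<in> contS" and p: "p \<in> S"
  shows "K (\<lambda>q. \<Sum>i<n. (K ^^ i) f q) p = (\<Sum>i<n. (K ^^ Suc i) f p)"
proof (induction n)
  case 0
  show ?case using K_scaleR[of 0 "\<lambda>q. 0" p] by simp
next
  case (Suc n)
  have cont: "(K ^^ i) f \<in> contS" for i by (induction i) (auto intro: f K_cont)
  then have "(\<lambda>q. \<Sum>i<n. (K ^^ i) f q) \<in> contS"
    by (auto simp: contS_def intro!: continuous_on_sum)
  then show ?case
    using K_add[OF p _ cont[of n]] Suc by simp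
qed

text \<open>The solution is the Neumann series \<open>\<psi> = \<Sum> K\<^sup>n (K f)\<close>. It converges uniformly, so \<open>K\<close> may be
  applied term by term, which shifts the series: \<open>K \<psi> = \<psi> - K f\<close>.\<close>

lemma exists_solution:
  assumes f: "f \<in> contS"
  obtains \<psi> where "\<psi> \<in> contS" "\<And>p. p \<in> S \<Longrightarrow> \<psi> p = K (\<lambda>q. f q + \<psi> q) p"
proof -
  define h where "h = K f"
  have h: "h \<in> contS" by (simp add: h_def K_cont f)
  obtain B \<theta> where \<theta>: "0 < \<theta>" "\<theta> < 1" and bound: "\<And>n p. p \<in> S \<Longrightarrow> vec_norm_1 ((K ^^ n) h p) \<le> B * \<theta> ^ n"
    by (rule K_iterates_geometric[OF h]) blast
  define \<psi> where "\<psi> p = (\<Sum>n. (K ^^ n) h p)" for p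
  define s where "s n p = (\<Sum>i<n. (K ^^ i) h p)" for n p
  have s: "s n \<in> contS" for n
  proof -
    have "(K ^^ i) h \<in> contS" for i by (induction i) (auto intro: h K_cont)
    then show ?thesis by (auto simp: s_def contS_def intro!: continuous_on_sum)
  qed
  have norm_bound: "norm ((K ^^ n) h p) \<le> B * \<theta> ^ n" if "p \<in> S" for n p
    using bound[OF that, of n] norm_le_vec_norm_1[of "(K ^^ n) h p"] by linarith
  have summable: "summable (\<lambda>n. B * \<theta> ^ n)"
    using \<theta> by (intro summable_mult summable_geometric) auto
  have unif: "uniform_limit S s \<psi> sequentially"
    unfolding s_def \<psi>_def by (rule Weierstrass_m_test[OF norm_bound summable])
  have \<psi>: "\<psi> \<in> contS"
    unfolding contS_def mem_Collect_eq
    by (rule uniform_limit_theorem[OF _ unif]) (use s in \<open>auto simp: contS_def\<close>)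
  have "\<psi> p = h p + K \<psi> p" if p: "p \<in> S" for p
  proof -
    have "(\<lambda>n. K (s n) p) \<longlonglongrightarrow> K \<psi> p"
    proof (rule metric_LIMSEQ_I)
      fix e :: real assume "e > 0"
      then have "eventually (\<lambda>n. \<forall>q\<in>S. dist (s n q) (\<psi> q) < e / 4) sequentially"
        using uniform_limitD[OF unif, of "e / 4"] by simp
      then obtain N where N: "\<And>n q. n \<ge> N \<Longrightarrow> q \<in> S \<Longrightarrow> norm (s n q - \<psi> q) < e / 4"
        by (auto simp: eventually_sequentially dist_norm)
      have "dist (K (s n) p) (K \<psi> p) < e" if "n \<ge> N" for n
      proof -
        have "\<forall>q\<in>S. vec_norm_1 (s n q - \<psi> q) \<le> e / 2"
        proof
          fix q assume "q \<in> S"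
          then show "vec_norm_1 (s n q - \<psi> q) \<le> e / 2"
            using N[OF that, of q] vec_norm_1_le_norm[of "s n q - \<psi> q"] by linarith
        qed
        then have "vec_norm_1 (K (\<lambda>q. s n q - \<psi> q) p) \<le> e / 2"
          by (rule K_bound[OF p contS_diff[OF s \<psi>]])
        then have "norm (K (s n) p - K \<psi> p) \<le> e / 2"
          using norm_le_vec_norm_1[of "K (s n) p - K \<psi> p"] K_diff[OF p s \<psi>] by simp
        then show ?thesis using \<open>e > 0\<close> by (simp add: dist_norm)
      qed
      then show "\<exists>N. \<forall>n\<ge>N. dist (K (s n) p) (K \<psi> p) < e" by blast
    qed
    moreover have "K (s n) p = s (Suc n) p - h p" for n
      unfolding s_def K_sum_iterates[OF h p] by (simp add: sum.lessThan_Suc_shift del: sum.lessThan_Suc)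
    moreover have "(\<lambda>n. s (Suc n) p - h p) \<longlonglongrightarrow> \<psi> p - h p"
      using tendsto_uniform_limitI[OF unif p] by (intro tendsto_intros LIMSEQ_Suc)
    ultimately have "K \<psi> p = \<psi> p - h p"
      using LIMSEQ_unique by fastforce
    then show ?thesis by simp
  qed
  then have "\<psi> p = K (\<lambda>q. f q + \<psi> q) p" if "p \<in> S" for p
    using K_add[OF that f \<psi>] that by (simp add: h_def)
  with \<psi> show ?thesis by (rule that)
qed

text \<open>Membership in \<open>C_fun S\<close> fixes the values off \<open>S\<close>, so the solution is restricted to \<open>S\<close>; \<open>K\<close> does
  not see the difference.\<close>

lemma unique_solution:
  assumes f: "f \<in> contS"
  shows "\<exists>!\<psi>. \<psi> \<in> C_fun S \<and> lippmann_schwinger k S V f \<psi>"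
proof -
  have LS: "lippmann_schwinger k S V f \<psi> \<longleftrightarrow> (\<forall>p\<in>S. \<psi> p = K (\<lambda>q. f q + \<psi> q) p)" for \<psi>
    by (simp add: lippmann_schwinger_def K_def)
  obtain \<psi> where \<psi>: "\<psi> \<in> contS" "\<And>p. p \<in> S \<Longrightarrow> \<psi> p = K (\<lambda>q. f q + \<psi> q) p"
    using exists_solution[OF f] by blast
  show ?thesis
  proof (rule ex1I[of _ "restrict \<psi> S"])
    have "restrict \<psi> S \<in> C_fun S"
      using \<psi>(1) by (auto simp: C_fun_def contS_def cong: continuous_on_cong)
    moreover have "K (\<lambda>q. f q + restrict \<psi> S q) p = K (\<lambda>q. f q + \<psi> q) p" for p
      by (rule K_cong) simp
    ultimately show "restrict \<psi> S \<in> C_fun S \<and> lippmann_schwinger k S V f (restrict \<psi> S)"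
      using \<psi>(2) by (simp add: LS)
  next
    fix \<phi> assume "\<phi> \<in> C_fun S \<and> lippmann_schwinger k S V f \<phi>"
    then have \<phi>: "\<phi> \<in> extensional S" "\<phi> \<in> contS" "\<And>p. p \<in> S \<Longrightarrow> \<phi> p = K (\<lambda>q. f q + \<phi> q) p"
      unfolding LS by (auto simp: C_fun_def contS_def)
    have "\<phi> p - \<psi> p = K (\<lambda>q. \<phi> q - \<psi> q) p" if p: "p \<in> S" for p
    proof -
      have "\<phi> p - \<psi> p = K (\<lambda>q. f q + \<phi> q) p - K (\<lambda>q. f q + \<psi> q) p"
        using \<phi>(3)[OF p] \<psi>(2)[OF p] by simp
      also have "\<dots> = K (\<lambda>q. \<phi> q - \<psi> q) p"
        using f \<phi>(2) \<psi>(1) p by (simp add: K_add K_diff)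
      finally show ?thesis .
    qed
    then have "\<phi> p - \<psi> p = 0" if "p \<in> S" for p
      using K_fixed_point_zero[OF contS_diff[OF \<phi>(2) \<psi>(1)] _ that] by blast
    then show "\<phi> = restrict \<psi> S"
      using \<phi>(1) by (auto simp: extensional_def restrict_def fun_eq_iff)
  qed
qed

end

lemma AE_Linf_bound:
  assumes "Linf_norm S V \<le> ereal v" "S \<in> sets lebesgue"
  shows "AE q in lebesgue. q \<in> S \<longrightarrow> cmod (V q) \<le> v"
proof -
  have "AE q in restrict_space lebesgue S. ereal (cmod (V q)) \<le> Linf_norm S V"
    unfolding Linf_norm_def by (rule esssup_AE)
  then have "AE q in restrict_space lebesgue S. cmod (V q) \<le> v"
    by eventually_elim (use assms(1) order_trans in fastforce)
  then show ?thesis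
    using assms(2) by (simp add: AE_restrict_space_iff)
qed

lemma Omega_cbox: "Omega Lx Ly = cbox (0, 0) (Lx, Ly)"
  by (auto simp: Omega_def cbox_Pair_eq)

theorem theorem2p2:
  fixes k Lx Ly :: real
    and V :: "real \<times> real \<Rightarrow> complex"
    and \<psi>\<^sub>0 :: "real \<times> real \<Rightarrow> complex^2"
  assumes "k > 0" and "Lx > 0" and "Ly > 0"
    and "in_Linf V"
    and "compact (ess_support V)" and "ess_support V \<subseteq> Omega Lx Ly"
    and "continuous_on (Omega Lx Ly) \<psi>\<^sub>0"
    and "free_dirac_on (interior (Omega Lx Ly)) k \<psi>\<^sub>0"
    and "Linf_norm (Omega Lx Ly) V \<le> ereal (1 / mu_a k (Omega Lx Ly))"
  shows "\<exists>!\<psi>\<^sub>s. \<psi>\<^sub>s \<in> C_fun (Omega Lx Ly) \<and>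
           lippmann_schwinger k (Omega Lx Ly) V \<psi>\<^sub>0 \<psi>\<^sub>s"
proof -
  let ?S = "Omega Lx Ly"
  have S: "compact ?S" "?S \<noteq> {}"
    using assms(2,3) by (simp_all add: Omega_cbox box_ne_empty Basis_prod_def)
  have interior: "interior ?S = {0<..<Lx} \<times> {0<..<Ly}"
    by (simp add: Omega_def interior_Times)
  have regular: "?S \<subseteq> closure (interior ?S)"
    using assms(2,3) by (simp add: interior closure_Times) (simp add: Omega_def)
  interpret green_domain k ?S
    by unfold_locales (use assms(1) S in auto)
  interpret dirac_scattering k ?S "1 / mu_a k ?S" V
  proof
    show "AE q in lebesgue. q \<in> ?S \<longrightarrow> cmod (V q) \<le> 1 / mu_a k ?S"
      by (rule AE_Linf_bound[OF assms(9)]) (use S in \<open>auto intro: fmeasurableD lmeasurable_compact\<close>)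
    show "V \<in> borel_measurable lebesgue" using assms(4) by (simp add: in_Linf_def)
  qed (use regular mu_nonneg in auto)
  show ?thesis
    by (rule unique_solution) (use assms(7) in \<open>simp add: contS_def\<close>)
qed

end
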